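(* Let $\{f(x)\}_{x\ge 0}$ be a Brownian motion with drift $\mu\in\mathbb{R}$, scale $\sigma\ge 0$, and initial value $f(0)\sim\mathcal{N}(\mu_0,\sigma_0^2)$. Let $n\ge 1$, let $0\le x_1\le x_2\le\dots\le x_n$ be sampling points, and let $y_i=f(x_i)+\varepsilon_i$ for $i=1,\dots,n$, where the errors $(\varepsilon_1,\dots,\varepsilon_n)$ are jointly Gaussian (with arbitrary variances and covariances), have mean $E[\varepsilon_i]=0$ for each $i$, and are independent of $\{f(x)\}_{x\ge 0}$. Let $\mathcal{D}=\{(x_i,y_i)\}_{i=1}^n$. Then for every $x\ge 0$ the conditional distribution of $f(x)$ given $\mathcal{D}$ is Gaussian. Moreover: (i) If $x\le x_1$ and $\sigma_0^2+\sigma^2x_1\neq 0$, then $$E[f(x)\mid\mathcal{D}]=\mu_0+\mu x+\frac{\sigma_0^2+\sigma^2x}{\sigma_0^2+\sigma^2x_1}\bigl(E[f(x_1)\mid\mathcal{D}]-\mu_0-\mu x_1\bigr)$$ and $$\mathrm{Var}(f(x)\mid\mathcal{D})=\left(\frac{\sigma_0^2+\sigma^2x}{\sigma_0^2+\sigma^2x_1}\right)^2\mathrm{Var}(f(x_1)\mid\mathcal{D})+\left(\frac{\sigma_0^2+\sigma^2x}{\sigma_0^2+\sigma^2x_1}\right)\sigma^2(x_1-x).$$ (ii) If $x_k\le x\le x_{k+1}$ for some $k<n$ with $x_k<x_{k+1}$, then $$E[f(x)\mid\mathcal{D}]=\frac{x_{k+1}-x}{x_{k+1}-x_k}E[f(x_k)\mid\mathcal{D}]+\frac{x-x_k}{x_{k+1}-x_k}E[f(x_{k+1})\mid\mathcal{D}]$$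 and $$\mathrm{Var}(f(x)\mid\mathcal{D})=\frac{1}{(x_{k+1}-x_k)^2}\begin{bmatrix}x_{k+1}-x\\ x-x_k\end{bmatrix}^T\mathrm{Var}\left(\begin{bmatrix}f(x_k)\\ f(x_{k+1})\end{bmatrix}\,\middle|\,\mathcal{D}\right)\begin{bmatrix}x_{k+1}-x\\ x-x_k\end{bmatrix}+\frac{\sigma^2(x_{k+1}-x)(x-x_k)}{x_{k+1}-x_k}.$$ (iii) If $x\ge x_n$, then $$E[f(x)\mid\mathcal{D}]=E[f(x_n)\mid\mathcal{D}]+\mu(x-x_n)$$ and $$\mathrm{Var}(f(x)\mid\mathcal{D})=\mathrm{Var}(f(x_n)\mid\mathcal{D})+\sigma^2(x-x_n).$$
   Context: A Brownian motion with drift $\mu$, scale $\sigma\ge 0$ and initial value $f(0)\sim\mathcal{N}(\mu_0,\sigma_0^2)$ (with $\mu_0\in\mathbb{R}$, $\sigma_0\ge 0$) is $f(x)=f(0)+\mu x+\sigma W(x)$, where $\{W(x)\}_{x\ge 0}$ is a standard Wiener process with $W(0)=0$, independent of $f(0)$. Equivalently for finite-dimensional distributions, it is a Gaussian process with mean function $m(x)=\mu_0+\mu x$ and covariance function $C(x,x')=\sigma_0^2+\sigma^2\min\{x,x'\}$ for $x,x'\ge 0$. Conditioning on $\mathcal{D}$ means conditioning on $(y_1,\dots,y_n)$, the points $x_i$ being fixed. $\mathrm{Var}(\cdot\mid\mathcal{D})$ denotes conditional variance (for a vector, the conditional $2\times2$ covariance matrix); equalities hold almost surely. "Gaussian" allows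 degenerate (zero-variance) distributions. *)

theory Defs
  imports "HOL-Probability.Probability"
begin

text \<open>The parameter \<open>s\<close> is the standard deviation, as in \<^const>\<open>normal_density\<close>; that density is
  identically zero for \<open>s = 0\<close>, so the degenerate law is given separately.\<close>

definition normal_measure :: "real \<Rightarrow> real \<Rightarrow> real measure" where
  "normal_measure m s =
     (if s = 0 then return borel m else density lborel (normal_density m s))"

definition gaussian_measure :: "real measure \<Rightarrow> bool" where
  "gaussian_measure N \<longleftrightarrow> (\<exists>m s. 0 \<le> s \<and> N = normal_measure m s)"

definition jointly_gaussian :: "'a measure \<Rightarrow> 'i set \<Rightarrow> ('i \<Rightarrow> 'a \<Rightarrow> real) \<Rightarrow> bool" where
  "jointly_gaussian M I X \<longleftrightarrow>
     (\<forall>i\<in>I. X i \<in> borel_measurable M) \<and>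
     (\<forall>c. gaussian_measure (distr M borel (\<lambda>\<omega>. \<Sum>i\<in>I. c i * X i \<omega>)))"

definition generated_algebra :: "'a measure \<Rightarrow> 'i set \<Rightarrow> ('i \<Rightarrow> 'a \<Rightarrow> real) \<Rightarrow> 'a measure" where
  "generated_algebra M I Y =
     vimage_algebra (space M) (\<lambda>\<omega>. \<lambda>i\<in>I. Y i \<omega>) (PiM I (\<lambda>_. borel))"

definition wiener_process :: "'a measure \<Rightarrow> (real \<Rightarrow> 'a \<Rightarrow> real) \<Rightarrow> bool" where
  "wiener_process M W \<longleftrightarrow>
     (\<forall>t\<ge>0. W t \<in> borel_measurable M) \<and>
     (AE \<omega> in M. W 0 \<omega> = 0) \<and>
     (\<forall>(t :: nat \<Rightarrow> real) m. 0 \<le> t 0 \<and> (\<forall>i<m. t i \<le> t (Suc i)) \<longrightarrow>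
        prob_space.indep_vars M (\<lambda>_. borel) (\<lambda>i \<omega>. W (t (Suc i)) \<omega> - W (t i) \<omega>) {..<m}) \<and>
     (\<forall>s t. 0 \<le> s \<and> s \<le> t \<longrightarrow>
        distr M borel (\<lambda>\<omega>. W t \<omega> - W s \<omega>) = normal_measure 0 (sqrt (t - s))) \<and>
     (AE \<omega> in M. continuous_on {0..} (\<lambda>t. W t \<omega>))"

text \<open>Only the values \<open>f x\<close> with \<open>0 \<le> x\<close> matter; \<open>\<mu>0\<close> and \<open>\<sigma>0\<close> are the mean and standard
  deviation of \<open>f 0\<close>.\<close>

definition brownian_motion_drift ::
  "'a measure \<Rightarrow> real \<Rightarrow> real \<Rightarrow> real \<Rightarrow> real \<Rightarrow> (real \<Rightarrow> 'a \<Rightarrow> real) \<Rightarrow> bool" where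
  "brownian_motion_drift M \<mu> \<sigma> \<mu>0 \<sigma>0 f \<longleftrightarrow>
     (\<forall>x\<ge>0. f x \<in> borel_measurable M) \<and>
     distr M borel (f 0) = normal_measure \<mu>0 \<sigma>0 \<and>
     (\<exists>W. wiener_process M W \<and>
        prob_space.indep_set M (sets (vimage_algebra (space M) (f 0) borel))
          (sets (generated_algebra M {0..} W)) \<and>
        (AE \<omega> in M. \<forall>x\<ge>0. f x \<omega> = f 0 \<omega> + \<mu> * x + \<sigma> * W x \<omega>))"

definition cond_cov ::
  "'a measure \<Rightarrow> 'a measure \<Rightarrow> ('a \<Rightarrow> real) \<Rightarrow> ('a \<Rightarrow> real) \<Rightarrow> 'a \<Rightarrow> real" where
  "cond_cov M F X Y = real_cond_exp M F
     (\<lambda>\<omega>. (X \<omega> - real_cond_exp M F X \<omega>) * (Y \<omega> - real_cond_exp M F Y \<omega>))"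

definition cond_var :: "'a measure \<Rightarrow> 'a measure \<Rightarrow> ('a \<Rightarrow> real) \<Rightarrow> 'a \<Rightarrow> real" where
  "cond_var M F X = real_cond_exp M F (\<lambda>\<omega>. (X \<omega> - real_cond_exp M F X \<omega>)\<^sup>2)"

definition cond_cov_matrix ::
  "'a measure \<Rightarrow> 'a measure \<Rightarrow> ('a \<Rightarrow> real ^ 'n) \<Rightarrow> 'a \<Rightarrow> real ^ 'n ^ 'n" where
  "cond_cov_matrix M F X \<omega> = (\<chi> i j. cond_cov M F (\<lambda>\<omega>. X \<omega> $ i) (\<lambda>\<omega>. X \<omega> $ j) \<omega>)"

text \<open>\<open>K\<close> is a regular conditional distribution of \<open>X\<close> given \<open>F\<close>; it is unique up to a null set.\<close>

definition cond_distribution ::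
  "'a measure \<Rightarrow> 'a measure \<Rightarrow> ('a \<Rightarrow> real) \<Rightarrow> ('a \<Rightarrow> real measure) \<Rightarrow> bool" where
  "cond_distribution M F X K \<longleftrightarrow>
     K \<in> measurable F (prob_algebra borel) \<and>
     (\<forall>A\<in>sets borel. AE \<omega> in M.
        measure (K \<omega>) A = real_cond_exp M F (indicator (X -` A \<inter> space M)) \<omega>)"

definition cond_gaussian :: "'a measure \<Rightarrow> 'a measure \<Rightarrow> ('a \<Rightarrow> real) \<Rightarrow> bool" where
  "cond_gaussian M F X \<longleftrightarrow>
     (\<exists>K. cond_distribution M F X K \<and> (AE \<omega> in M. gaussian_measure (K \<omega>)))"

end

theory Submission
  imports Defs
begin

text \<open>The variables \<open>f t\<close> and \<open>\<epsilon> i\<close> span a space of jointly Gaussian variables, in which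
  uncorrelated means independent. Hence every \<open>U\<close> of the space splits as \<open>L + Z\<close> with \<open>L\<close> affine in
  the data and \<open>Z\<close> centred and independent of the data, so that the conditional law of \<open>U\<close> is the law
  of \<open>Z\<close> shifted by \<open>L\<close>. In each of the three cases \<open>f x\<close> is an affine combination of values of \<open>f\<close>
  at neighbouring sampling points plus a residual which, by the covariance \<open>\<sigma>0\<^sup>2 + \<sigma>\<^sup>2 min s t\<close>, is
  uncorrelated with all data and with these values; the formulas follow by linearity.\<close>

section \<open>Normal distributions\<close>

text \<open>The covariance matrix of the data may be singular: errors can be degenerate, sampling
  points can coincide, and \<open>\<sigma>\<close> or \<open>\<sigma>0\<close> can vanish. This
  rules out formulas through a joint density or an inverse matrix, so the argument speaks only of
  covariances and residuals, and residuals are built by adding one observation at a time. Joint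
  Gaussianity is available only through the laws of linear combinations. Independence is therefore
  read off from characteristic functions, and the multivariate uniqueness this requires is reduced
  to Levy uniqueness on the line by exchanging exponentials for indicators one coordinate at a time.
  The three formulas relate conditional moments at \<open>x\<close> to conditional moments at
  sampling points. Conditional covariances turn out to be almost everywhere equal to the constant
  covariances of residuals, so it is enough to compare residuals, and no regression coefficient on
  the data is ever computed.\<close>

lemma normal_measure_affine:
  assumes "0 \<le> s"
  shows "normal_measure m s = distr std_normal_distribution borel (\<lambda>z. m + s * z)"
proof (cases "s = 0")
  case True
  interpret real_distribution std_normal_distribution by (rule real_dist_normal_dist)
  show ?thesis using True
    by (simp add: normal_measure_def distr_const)
next
  case False
  then have s: "0 < s" using assms by simp
  interpret real_distribution std_normal_distribution by (rule real_dist_normal_dist)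
  have "distributed std_normal_distribution lborel (\<lambda>z. z) std_normal_density"
    by (auto simp: distributed_def distr_id2)
  from normal_density_affine[OF this, of s m] s
  have "distributed std_normal_distribution lborel (\<lambda>z. m + s * z) (normal_density m s)"
    by simp
  then have "distr std_normal_distribution lborel (\<lambda>z. m + s * z) = density lborel (normal_density m s)"
    by (simp add: distributed_def)
  moreover have "distr std_normal_distribution lborel (\<lambda>z. m + s * z)
      = distr std_normal_distribution borel (\<lambda>z. m + s * z)"
    by (rule distr_cong) auto
  ultimately show ?thesis using False by (simp add: normal_measure_def)
qed

lemma real_distribution_normal_measure:
  assumes "0 \<le> s"
  shows "real_distribution (normal_measure m s)"
proof -
  interpret real_distribution std_normal_distribution by (rule real_dist_normal_dist)
  show ?thesis
    unfolding normal_measure_affine[OF assms] by (rule real_distribution_distr) simp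
qed

text \<open>Transporting along an affine image of the standard normal law treats
  \<open>s = 0\<close> together with \<open>s > 0\<close>; the moments below are obtained in the
  same way.\<close>

lemma char_normal_measure:
  assumes "0 \<le> s"
  shows "char (normal_measure m s) t = iexp (t * m) * exp (- (s\<^sup>2 * t\<^sup>2) / 2)"
proof -
  have "char (normal_measure m s) t = (CLINT z|std_normal_distribution. iexp (t * m) * iexp (t * s * z))"
    unfolding normal_measure_affine[OF assms] char_def
    by (subst integral_distr) (auto simp: algebra_simps exp_add)
  also have "\<dots> = iexp (t * m) * char std_normal_distribution (t * s)"
    by (simp add: char_def)
  also have "\<dots> = iexp (t * m) * exp (- (s\<^sup>2 * t\<^sup>2) / 2)"
    by (simp add: char_std_normal_distribution power_mult_distrib mult.commute exp_of_real[symmetric])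
  finally show ?thesis .
qed

lemma normal_measure_moments:
  assumes "0 \<le> s"
  shows "integrable (normal_measure m s) (\<lambda>z. z)"
    and "integrable (normal_measure m s) (\<lambda>z. z\<^sup>2)"
    and "integral\<^sup>L (normal_measure m s) (\<lambda>z. z) = m"
    and "integral\<^sup>L (normal_measure m s) (\<lambda>z. (z - m)\<^sup>2) = s\<^sup>2"
proof -
  interpret real_distribution std_normal_distribution by (rule real_dist_normal_dist)
  have 1: "integrable std_normal_distribution (\<lambda>z. z)"
    using integrable_std_normal_distribution_moment[of 1] by simp
  have 2: "integrable std_normal_distribution (\<lambda>z. z * z)"
    using integrable_std_normal_distribution_moment[of 2] by (simp add: power2_eq_square)
  have 3: "integral\<^sup>L std_normal_distribution (\<lambda>z. z) = 0"
    using integral_std_normal_distribution_moment_odd[of 1] by simp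
  have 4: "integral\<^sup>L std_normal_distribution (\<lambda>z. z * z) = 1"
    using std_normal_distribution_even_moments(1)[of 1] by (simp add: power2_eq_square)
  have P: "integral\<^sup>L std_normal_distribution (\<lambda>z. c) = c" for c :: real
    using prob_space by simp
  have eq: "(m + s * z)\<^sup>2 = m * m + 2 * m * s * z + s * s * (z * z)" for z
    by (simp add: power2_eq_square algebra_simps)
  have "integrable std_normal_distribution (\<lambda>z. m + s * z)"
    by (intro Bochner_Integration.integrable_add integrable_mult_right integrable_const 1)
  then show "integrable (normal_measure m s) (\<lambda>z. z)"
    unfolding normal_measure_affine[OF assms] by (simp add: integrable_distr_eq)
  have "integrable std_normal_distribution (\<lambda>z. (m + s * z)\<^sup>2)"
    unfolding eq by (intro Bochner_Integration.integrable_add integrable_mult_right integrable_const 1 2)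
  then show "integrable (normal_measure m s) (\<lambda>z. z\<^sup>2)"
    unfolding normal_measure_affine[OF assms] by (simp add: integrable_distr_eq)
  have "integral\<^sup>L std_normal_distribution (\<lambda>z. m + s * z) = m"
    using 1 3 P by simp
  then show "integral\<^sup>L (normal_measure m s) (\<lambda>z. z) = m"
    unfolding normal_measure_affine[OF assms] by (simp add: integral_distr)
  have "integral\<^sup>L std_normal_distribution (\<lambda>z. (s * z)\<^sup>2) = s\<^sup>2"
    using 4 by (simp add: power_mult_distrib power2_eq_square[symmetric])
  then show "integral\<^sup>L (normal_measure m s) (\<lambda>z. (z - m)\<^sup>2) = s\<^sup>2"
    unfolding normal_measure_affine[OF assms] by (simp add: integral_distr)
qed

lemma (in prob_space) gaussian_variable:
  fixes X :: "'a \<Rightarrow> real"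
  assumes X [measurable]: "X \<in> borel_measurable M" and "gaussian_measure (distr M borel X)"
  shows gaussian_integrable: "integrable M X"
    and gaussian_square_integrable: "integrable M (\<lambda>\<omega>. (X \<omega>)\<^sup>2)"
    and gaussian_char: "char (distr M borel X) t = iexp (t * expectation X) * exp (- (variance X * t\<^sup>2) / 2)"
proof -
  obtain m s where s: "0 \<le> s" and N: "distr M borel X = normal_measure m s"
    using assms(2) by (auto simp: gaussian_measure_def)
  show "integrable M X"
    using normal_measure_moments(1)[OF s, of m] by (simp add: N[symmetric] integrable_distr_eq)
  show "integrable M (\<lambda>\<omega>. (X \<omega>)\<^sup>2)"
    using normal_measure_moments(2)[OF s, of m] by (simp add: N[symmetric] integrable_distr_eq)
  have m: "expectation X = m"
    using normal_measure_moments(3)[OF s, of m] by (simp add: N[symmetric] integral_distr)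
  have v: "variance X = s\<^sup>2"
    using normal_measure_moments(4)[OF s, of m] by (simp add: N[symmetric] integral_distr m)
  show "char (distr M borel X) t = iexp (t * expectation X) * exp (- (variance X * t\<^sup>2) / 2)"
    using v by (simp add: N m char_normal_measure[OF s])
qed

lemma (in prob_space) gaussian_measureI_char:
  fixes X :: "'a \<Rightarrow> real"
  assumes X [measurable]: "X \<in> borel_measurable M" and "0 \<le> v"
    and "\<And>t. char (distr M borel X) t = iexp (t * m) * exp (- (v * t\<^sup>2) / 2)"
  shows "gaussian_measure (distr M borel X)"
proof -
  have "distr M borel X = normal_measure m (sqrt v)"
    using assms by (intro Levy_uniqueness real_distribution_distr real_distribution_normal_measure ext)
      (auto simp: char_normal_measure)
  then show ?thesis using assms(2) by (metis gaussian_measure_def real_sqrt_ge_zero)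
qed

lemma (in prob_space) gaussian_measure_add:
  fixes X Y :: "'a \<Rightarrow> real"
  assumes "indep_var borel X borel Y"
    and "gaussian_measure (distr M borel X)" "gaussian_measure (distr M borel Y)"
  shows "gaussian_measure (distr M borel (\<lambda>\<omega>. X \<omega> + Y \<omega>))"
proof -
  have X [measurable]: "X \<in> borel_measurable M" and Y [measurable]: "Y \<in> borel_measurable M"
    using indep_var_rv1 indep_var_rv2 assms(1) by blast+
  show ?thesis
  proof (rule gaussian_measureI_char[where m = "expectation X + expectation Y" and v = "variance X + variance Y"])
    fix t
    have exp_split: "exp (- ((variance X + variance Y) * t\<^sup>2) / 2) =
        exp (- (variance X * t\<^sup>2) / 2) * exp (- (variance Y * t\<^sup>2) / 2)"
      unfolding exp_add[symmetric] by (simp add: algebra_simps add_divide_distrib diff_divide_distrib)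
    show "char (distr M borel (\<lambda>\<omega>. X \<omega> + Y \<omega>)) t =
       iexp (t * (expectation X + expectation Y)) * exp (- ((variance X + variance Y) * t\<^sup>2) / 2)"
      unfolding char_distr_add[OF assms(1)] gaussian_char[OF X assms(2)] gaussian_char[OF Y assms(3)]
      by (subst exp_split) (simp add: algebra_simps exp_add)
  qed (auto intro!: add_nonneg_nonneg)
qed

lemma (in prob_space) gaussian_measure_affine:
  fixes X :: "'a \<Rightarrow> real"
  assumes X [measurable]: "X \<in> borel_measurable M" and "gaussian_measure (distr M borel X)"
  shows "gaussian_measure (distr M borel (\<lambda>\<omega>. a + b * X \<omega>))"
proof (rule gaussian_measureI_char[where m = "a + b * expectation X" and v = "b\<^sup>2 * variance X"])
  fix t
  have "char (distr M borel (\<lambda>\<omega>. a + b * X \<omega>)) t = iexp (t * a) * char (distr M borel X) (t * b)"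
    unfolding char_def by (simp add: integral_distr algebra_simps exp_add)
  then show "char (distr M borel (\<lambda>\<omega>. a + b * X \<omega>)) t =
      iexp (t * (a + b * expectation X)) * exp (- (b\<^sup>2 * variance X * t\<^sup>2) / 2)"
    by (simp add: gaussian_char[OF X assms(2)] algebra_simps exp_add power_mult_distrib)
qed auto

lemma (in prob_space) gaussian_measure_sum:
  fixes X :: "'i \<Rightarrow> 'a \<Rightarrow> real"
  assumes "finite I" "indep_vars (\<lambda>_. borel) X I" "\<And>i. i \<in> I \<Longrightarrow> gaussian_measure (distr M borel (X i))"
  shows "gaussian_measure (distr M borel (\<lambda>\<omega>. \<Sum>i\<in>I. X i \<omega>))"
  using assms
proof (induction I rule: finite_induct)
  case empty
  have "distr M borel (\<lambda>\<omega>. 0 :: real) = normal_measure 0 0"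
    by (simp add: normal_measure_def distr_const)
  then show ?case by (auto simp: gaussian_measure_def intro!: exI[of _ 0])
next
  case (insert i I)
  have "gaussian_measure (distr M borel (\<lambda>\<omega>. X i \<omega> + (\<Sum>i\<in>I. X i \<omega>)))"
    using insert indep_vars_subset[OF insert.prems(1), of I]
    by (intro gaussian_measure_add indep_vars_sum) auto
  then show ?case using insert.hyps by simp
qed

section \<open>Independence from characteristic functions\<close>

context prob_space
begin

section \<open>Uniqueness of Fourier transforms for weighted laws\<close>

lemma integrable_bounded_mult_iexp:
  fixes G :: "'a \<Rightarrow> complex" and U :: "'a \<Rightarrow> real"
  assumes [measurable]: "G \<in> borel_measurable M" "U \<in> borel_measurable M"
    and "\<And>\<omega>. norm (G \<omega>) \<le> C"
  shows "integrable M (\<lambda>\<omega>. G \<omega> * iexp (U \<omega>))"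
  using assms(3) by (intro integrable_const_bound[of _ C]) (auto simp: norm_mult)

text \<open>The image under \<open>Y\<close> of the signed measure with density \<open>G\<close> has
  zero Fourier transform, hence should vanish. Levy uniqueness speaks of probability measures, so
  the signed weight is replaced by the probability density \<open>1 + G / c\<close>: under it
  \<open>Y\<close> has the same characteristic function as under \<open>M\<close>, hence the same
  law, and the difference of the two laws is the contribution of \<open>G / c\<close>.\<close>

lemma fourier_vanish_real:
  fixes G Y :: "'a \<Rightarrow> real"
  assumes [measurable]: "G \<in> borel_measurable M" "Y \<in> borel_measurable M"
    and bound: "\<And>\<omega>. \<bar>G \<omega>\<bar> \<le> C"
    and zero: "\<And>t. (CLINT \<omega>|M. G \<omega> * iexp (t * Y \<omega>)) = 0"
    and A [measurable]: "A \<in> sets borel"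
  shows "(LINT \<omega>|M. G \<omega> * indicator A (Y \<omega>)) = 0"
proof -
  \<comment> \<open>The summand 1 keeps \<open>c\<close> positive when \<open>C = 0\<close>, so that
    one may divide by it.\<close>
  define c where "c = C + 1"
  have c: "0 < c" and bc: "\<bar>G \<omega>\<bar> \<le> c" for \<omega>
    using bound[of undefined] bound[of \<omega>] by (auto simp: c_def)
  have intG: "integrable M G"
    using bound by (intro integrable_const_bound[of _ C]) auto
  have intG1: "integrable M (\<lambda>\<omega>. G \<omega> * indicator A (Y \<omega>))"
    by (intro integrable_const_bound[of _ c]) (auto simp: abs_mult indicator_def bc intro: less_imp_le c)
  have intA: "integrable M (\<lambda>\<omega>. indicator A (Y \<omega>) :: real)"
    by (intro integrable_const_bound[of _ 1]) auto
  \<comment> \<open>The hypothesis at \<open>t = 0\<close>; it gives the density \<open>p\<close>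
    total mass one.\<close>
  have "expectation G = 0"
  proof -
    have "complex_of_real (expectation G) = (CLINT \<omega>|M. G \<omega> * iexp (0 * Y \<omega>))"
      by simp
    then show ?thesis unfolding zero by simp
  qed
  define p where "p = (\<lambda>\<omega>. 1 + G \<omega> / c)"
  have p [measurable]: "p \<in> borel_measurable M" by (simp add: p_def)
  have p0: "0 \<le> p \<omega>" for \<omega>
    using bc[of \<omega>] c by (simp add: p_def field_simps abs_le_iff)
  have "integrable M p" unfolding p_def
    by (intro Bochner_Integration.integrable_add integrable_const integrable_divide intG) 
  have "expectation p = 1"
    using intG \<open>expectation G = 0\<close> by (simp add: p_def prob_space)
  define N where "N = density M p"
  have "emeasure N (space N) = 1"
    using \<open>integrable M p\<close> p0 \<open>expectation p = 1\<close>
    by (simp add: N_def emeasure_density nn_integral_eq_integral cong: nn_integral_cong)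
  then interpret N: prob_space N by (rule prob_spaceI)
  have [measurable]: "Y \<in> borel_measurable N" by (simp add: N_def)
  have "distr N borel Y = distr M borel Y"
  proof (intro Levy_uniqueness N.real_distribution_distr real_distribution_distr ext)
    fix t
    have i1: "integrable M (\<lambda>\<omega>. iexp (t * Y \<omega>))"
      using integrable_bounded_mult_iexp[of "\<lambda>_. 1" "\<lambda>\<omega>. t * Y \<omega>" 1] by simp
    have i2: "integrable M (\<lambda>\<omega>. G \<omega> * iexp (t * Y \<omega>))"
      using integrable_bounded_mult_iexp[of "\<lambda>\<omega>. G \<omega>" "\<lambda>\<omega>. t * Y \<omega>" C] bound by simp
    have "char (distr N borel Y) t = (CLINT \<omega>|M. p \<omega> *\<^sub>R iexp (t * Y \<omega>))"
      by (simp add: char_def integral_distr N_def integral_density p0)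
    also have "\<dots> = (CLINT \<omega>|M. iexp (t * Y \<omega>) + (1 / c) * (G \<omega> * iexp (t * Y \<omega>)))"
      by (simp add: p_def scaleR_conv_of_real algebra_simps)
    also have "\<dots> = (CLINT \<omega>|M. iexp (t * Y \<omega>)) + (1 / c) * (CLINT \<omega>|M. G \<omega> * iexp (t * Y \<omega>))"
      using i1 i2 by (subst Bochner_Integration.integral_add) auto
    also have "\<dots> = char (distr M borel Y) t"
      unfolding zero by (simp add: char_def integral_distr)
    finally show "char (distr N borel Y) t = char (distr M borel Y) t" .
  qed auto
  then have "integral\<^sup>L (distr N borel Y) (indicator A :: real \<Rightarrow> real)
      = integral\<^sup>L (distr M borel Y) (indicator A)"
    by simp
  then have "(LINT \<omega>|M. p \<omega> * indicator A (Y \<omega>)) = (LINT \<omega>|M. indicator A (Y \<omega>))"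
    by (simp only: N_def integral_distr integral_density p0 A borel_measurable_indicator
        \<open>Y \<in> borel_measurable N\<close>[unfolded N_def] assms(2) measurable_compose[OF assms(2)]
        p AE_I2 real_scaleR_def)
  also have "(LINT \<omega>|M. p \<omega> * indicator A (Y \<omega>))
      = (LINT \<omega>|M. indicator A (Y \<omega>) + (1 / c) * (G \<omega> * indicator A (Y \<omega>)))"
    by (simp add: p_def algebra_simps)
  also have "\<dots> = (LINT \<omega>|M. indicator A (Y \<omega>)) + (1 / c) * (LINT \<omega>|M. G \<omega> * indicator A (Y \<omega>))"
    using intG1 intA by (subst Bochner_Integration.integral_add) auto
  finally show ?thesis using c by simp
qed

text \<open>Real and imaginary part of \<open>G\<close> are linear combinations of \<open>G\<close>
  and its conjugate. The conjugate inherits the vanishing hypothesis, because conjugating the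
  integral at \<open>- t\<close> gives its integral at \<open>t\<close>; the real case then applies
  to both parts.\<close>

lemma fourier_vanish:
  fixes G :: "'a \<Rightarrow> complex" and Y :: "'a \<Rightarrow> real"
  assumes G [measurable]: "G \<in> borel_measurable M" and Y [measurable]: "Y \<in> borel_measurable M"
    and bound: "\<And>\<omega>. norm (G \<omega>) \<le> C"
    and zero: "\<And>t. (CLINT \<omega>|M. G \<omega> * iexp (t * Y \<omega>)) = 0"
    and A [measurable]: "A \<in> sets borel"
  shows "(CLINT \<omega>|M. G \<omega> * indicator A (Y \<omega>)) = 0"
proof -
  have [measurable]: "(\<lambda>\<omega>. cnj (G \<omega>)) \<in> borel_measurable M"
    by (rule borel_measurable_continuous_on[OF _ G]) (intro continuous_intros)
  have int: "integrable M (\<lambda>\<omega>. G \<omega> * iexp (t * Y \<omega>))" for t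
    by (rule integrable_bounded_mult_iexp[where C = C]) (auto simp: bound)
  have zero': "(CLINT \<omega>|M. cnj (G \<omega>) * iexp (t * Y \<omega>)) = 0" for t
  proof -
    have "(CLINT \<omega>|M. cnj (G \<omega> * iexp ((- t) * Y \<omega>))) = cnj (CLINT \<omega>|M. G \<omega> * iexp ((- t) * Y \<omega>))"
      by (simp add: integral_cnj[symmetric] del: complex_cnj_mult)
    then show ?thesis unfolding zero by (simp add: exp_cnj)
  qed
  have int': "integrable M (\<lambda>\<omega>. cnj (G \<omega>) * iexp (t * Y \<omega>))" for t
    by (rule integrable_bounded_mult_iexp[where C = C]) (auto simp: bound)
  have Re_eq: "complex_of_real (Re z) = (1/2) * z + (1/2) * cnj z"
    and Im_eq: "complex_of_real (Im z) = (- \<i>/2) * z + (\<i>/2) * cnj z" for z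
    by (auto simp: complex_eq_iff)
  have Re: "(LINT \<omega>|M. Re (G \<omega>) * indicator A (Y \<omega>)) = 0"
  proof (rule fourier_vanish_real[where C = C])
    show "(CLINT \<omega>|M. Re (G \<omega>) * iexp (t * Y \<omega>)) = 0" for t
      unfolding Re_eq distrib_right mult.assoc using int[of t] int'[of t] zero[of t] zero'[of t]
      by (subst Bochner_Integration.integral_add) auto
    show "\<bar>Re (G \<omega>)\<bar> \<le> C" for \<omega>
      using bound[of \<omega>] abs_Re_le_cmod[of "G \<omega>"] by linarith
  qed auto
  have Im: "(LINT \<omega>|M. Im (G \<omega>) * indicator A (Y \<omega>)) = 0"
  proof (rule fourier_vanish_real[where C = C])
    show "(CLINT \<omega>|M. Im (G \<omega>) * iexp (t * Y \<omega>)) = 0" for t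
      unfolding Im_eq distrib_right mult.assoc using int[of t] int'[of t] zero[of t] zero'[of t]
      by (subst Bochner_Integration.integral_add) auto
    show "\<bar>Im (G \<omega>)\<bar> \<le> C" for \<omega>
      using bound[of \<omega>] abs_Im_le_cmod[of "G \<omega>"] by linarith
  qed auto
  have "integrable M (\<lambda>\<omega>. G \<omega> * indicator A (Y \<omega>))"
    using bound norm_ge_zero[of "G undefined"] order_trans[OF norm_ge_zero bound]
    by (intro integrable_const_bound[of _ C]) (auto simp: norm_mult indicator_def)
  then have "Re (CLINT \<omega>|M. G \<omega> * indicator A (Y \<omega>)) = (LINT \<omega>|M. Re (G \<omega> * indicator A (Y \<omega>)))"
    and "Im (CLINT \<omega>|M. G \<omega> * indicator A (Y \<omega>)) = (LINT \<omega>|M. Im (G \<omega> * indicator A (Y \<omega>)))"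
    by (simp_all only: integral_Re integral_Im)
  moreover have "Re (G \<omega> * indicator A (Y \<omega>)) = Re (G \<omega>) * indicator A (Y \<omega>)"
    "Im (G \<omega> * indicator A (Y \<omega>)) = Im (G \<omega>) * indicator A (Y \<omega>)" for \<omega>
    by (auto simp: indicator_def)
  ultimately show ?thesis using Re Im by (simp add: complex_eq_iff)
qed

text \<open>One exponential at a time is exchanged for an indicator. While coordinate
  \<open>j\<close> is treated, the remaining exponentials are absorbed into the weight, and
  afterwards its indicator is absorbed in turn. This is why the weight is complex and arbitrary in
  the induction; all absorbed factors have norm at most 1, so the bound \<open>C\<close>
  persists.\<close>

lemma fourier_vanish_finite:
  fixes G :: "'a \<Rightarrow> complex" and Y :: "'i \<Rightarrow> 'a \<Rightarrow> real"
  assumes "finite I" "G \<in> borel_measurable M" "\<And>i. i \<in> I \<Longrightarrow> Y i \<in> borel_measurable M"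
    and "\<And>\<omega>. norm (G \<omega>) \<le> C"
    and "\<And>t. (CLINT \<omega>|M. G \<omega> * iexp (\<Sum>i\<in>I. t i * Y i \<omega>)) = 0"
    and "\<And>i. i \<in> I \<Longrightarrow> A i \<in> sets borel"
  shows "(CLINT \<omega>|M. G \<omega> * (\<Prod>i\<in>I. indicator (A i) (Y i \<omega>))) = 0"
  using assms
proof (induction I arbitrary: G rule: finite_induct)
  case empty
  then show ?case by simp
next
  case (insert j I)
  note [measurable] = \<open>G \<in> borel_measurable M\<close>
  have [measurable]: "Y i \<in> borel_measurable M" "A i \<in> sets borel" if "i \<in> insert j I" for i
    using that insert.prems by auto
  have "(CLINT \<omega>|M. (G \<omega> * indicator (A j) (Y j \<omega>)) * (\<Prod>i\<in>I. indicator (A i) (Y i \<omega>))) = 0"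
  proof (rule insert.IH)
    show "norm (G \<omega> * indicator (A j) (Y j \<omega>)) \<le> C" for \<omega>
      using insert.prems(3)[of \<omega>] order_trans[OF norm_ge_zero insert.prems(3)]
      by (auto simp: indicator_def norm_mult)
    fix t
    have "(CLINT \<omega>|M. (G \<omega> * iexp (\<Sum>i\<in>I. t i * Y i \<omega>)) * indicator (A j) (Y j \<omega>)) = 0"
    proof (rule fourier_vanish[where C = C])
      show "norm (G \<omega> * iexp (\<Sum>i\<in>I. t i * Y i \<omega>)) \<le> C" for \<omega>
        using insert.prems(3) by (simp add: norm_mult del: of_real_sum)
      fix s
      \<comment> \<open>The coefficient at \<open>j\<close> is free, because \<open>t\<close> is
        only used on \<open>I\<close>. Varying it as \<open>s\<close> gives the one-dimensional
        hypothesis for \<open>Y j\<close>.\<close>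
      have "(\<Sum>i\<in>insert j I. (t(j := s)) i * Y i \<omega>) = (\<Sum>i\<in>I. t i * Y i \<omega>) + s * Y j \<omega>" for \<omega>
        using insert.hyps by (auto intro!: sum.cong)
      then have "iexp (\<Sum>i\<in>insert j I. (t(j := s)) i * Y i \<omega>)
          = iexp (\<Sum>i\<in>I. t i * Y i \<omega>) * iexp (s * Y j \<omega>)" for \<omega>
        by (simp only: of_real_add distrib_left exp_add)
      then show "(CLINT \<omega>|M. (G \<omega> * iexp (\<Sum>i\<in>I. t i * Y i \<omega>)) * iexp (s * Y j \<omega>)) = 0"
        using insert.prems(4)[of "t(j := s)"] by (simp only: mult.assoc)
    qed auto
    then show "(CLINT \<omega>|M. (G \<omega> * indicator (A j) (Y j \<omega>)) * iexp (\<Sum>i\<in>I. t i * Y i \<omega>)) = 0"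
      by (simp only: mult_ac)
  qed auto
  then show ?case using insert.hyps by (simp add: mult.assoc)
qed

text \<open>Supplies a generator made of preimages of boxes. It is stable under intersection, so
  independence has to be checked on boxes only.\<close>

lemma sets_generated_algebra_finite:
  assumes "finite I"
  shows "sets (generated_algebra M I Y) =
    sigma_sets (space M) {{\<omega> \<in> space M. \<forall>i\<in>I. Y i \<omega> \<in> A i} |A. \<forall>i\<in>I. A i \<in> sets borel}"
proof -
  have "sets (generated_algebra M I Y) =
      {(\<lambda>\<omega>. \<lambda>i\<in>I. Y i \<omega>) -` B \<inter> space M |B. B \<in> sigma_sets (\<Pi>\<^sub>E i\<in>I. space borel) (prod_algebra I (\<lambda>_. borel))}"
    unfolding generated_algebra_def by (subst sets_vimage_algebra2) (auto simp: space_PiM sets_PiM)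
  also have "\<dots> = sigma_sets (space M) {(\<lambda>\<omega>. \<lambda>i\<in>I. Y i \<omega>) -` B \<inter> space M |B. B \<in> prod_algebra I (\<lambda>_. borel)}"
    by (rule sigma_sets_vimage_commute) auto
  also have "{(\<lambda>\<omega>. \<lambda>i\<in>I. Y i \<omega>) -` B \<inter> space M |B. B \<in> prod_algebra I (\<lambda>_. borel)}
      = {{\<omega> \<in> space M. \<forall>i\<in>I. Y i \<omega> \<in> A i} |A. \<forall>i\<in>I. A i \<in> sets borel}"
  proof -
    have eq: "(\<lambda>\<omega>. \<lambda>i\<in>I. Y i \<omega>) -` (\<Pi>\<^sub>E i\<in>I. A i) \<inter> space M = {\<omega> \<in> space M. \<forall>i\<in>I. Y i \<omega> \<in> A i}" for A
      by (auto simp: PiE_iff)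
    show ?thesis unfolding prod_algebra_eq_finite[OF assms] Pi_iff eq[symmetric] by blast
  qed
  finally show ?thesis .
qed

text \<open>Fourier uniqueness is used twice. For fixed \<open>s\<close>, it first replaces the
  exponentials in the \<open>Y i\<close> by indicators of a box; for a fixed box event, it then
  replaces the exponentials in \<open>Z\<close> by the indicator of a Borel set. What results is the
  product rule on two intersection-stable generators.\<close>

lemma indep_of_char:
  fixes Z :: "'a \<Rightarrow> real" and Y :: "'i \<Rightarrow> 'a \<Rightarrow> real"
  assumes "finite I" and Z [measurable]: "Z \<in> borel_measurable M"
    and Y: "\<And>i. i \<in> I \<Longrightarrow> Y i \<in> borel_measurable M"
    and char: "\<And>s t. (CLINT \<omega>|M. iexp (s * Z \<omega>) * iexp (\<Sum>i\<in>I. t i * Y i \<omega>)) =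
      (CLINT \<omega>|M. iexp (s * Z \<omega>)) * (CLINT \<omega>|M. iexp (\<Sum>i\<in>I. t i * Y i \<omega>))"
  shows "indep_set (sets (generated_algebra M I Y)) (sets (vimage_algebra (space M) Z borel))"
proof -
  have [measurable]: "Y i \<in> borel_measurable M" if "i \<in> I" for i
    using that Y by auto
  let ?P = "{{\<omega> \<in> space M. \<forall>i\<in>I. Y i \<omega> \<in> A i} |A. \<forall>i\<in>I. A i \<in> sets borel}"
  let ?Q = "{Z -` B \<inter> space M |B. B \<in> sets borel}"
  have rect: "(CLINT \<omega>|M. iexp (s * Z \<omega>) * (\<Prod>i\<in>I. indicator (A i) (Y i \<omega>))) =
      (CLINT \<omega>|M. iexp (s * Z \<omega>)) * (CLINT \<omega>|M. (\<Prod>i\<in>I. indicator (A i) (Y i \<omega>)))"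
    if [measurable]: "\<And>i. i \<in> I \<Longrightarrow> A i \<in> sets borel" for A s
  proof -
    define c where "c = (CLINT \<omega>|M. iexp (s * Z \<omega>))"
    have int: "integrable M (\<lambda>\<omega>. iexp (s * Z \<omega>) * iexp (U \<omega>))" if [measurable]: "U \<in> borel_measurable M" for U
      by (rule integrable_bounded_mult_iexp[where C = 1]) auto
    have intU: "integrable M (\<lambda>\<omega>. iexp (U \<omega>))" if [measurable]: "U \<in> borel_measurable M" for U
      by (rule integrable_const_bound[where B = 1]) auto
    have ind: "norm (\<Prod>i\<in>I. indicator (A i) (Y i \<omega>) :: complex) \<le> 1" for \<omega>
      unfolding prod_norm[symmetric] by (rule prod_le_1) (auto simp: indicator_def)
    \<comment> \<open>Subtracting the mean \<open>c\<close> of the exponential turns the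
      factorization of expectations into the vanishing of an integral.\<close>
    have "(CLINT \<omega>|M. (iexp (s * Z \<omega>) - c) * (\<Prod>i\<in>I. indicator (A i) (Y i \<omega>))) = 0"
    proof (rule fourier_vanish_finite[where C = "1 + norm c"])
      show "norm (iexp (s * Z \<omega>) - c) \<le> 1 + norm c" for \<omega>
        using norm_triangle_ineq4[of "iexp (s * Z \<omega>)" c] by (simp del: of_real_mult)
      fix t
      show "(CLINT \<omega>|M. (iexp (s * Z \<omega>) - c) * iexp (\<Sum>i\<in>I. t i * Y i \<omega>)) = 0"
        unfolding left_diff_distrib
        using int[of "\<lambda>\<omega>. \<Sum>i\<in>I. t i * Y i \<omega>"] intU[of "\<lambda>\<omega>. \<Sum>i\<in>I. t i * Y i \<omega>"] char[of s t]
        by (subst Bochner_Integration.integral_diff) (auto simp: c_def simp del: of_real_sum)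
    qed (use assms(1) that in auto)
    moreover have "integrable M (\<lambda>\<omega>. iexp (s * Z \<omega>) * (\<Prod>i\<in>I. indicator (A i) (Y i \<omega>)))"
      using ind by (intro integrable_const_bound[where B = 1]) (auto simp: norm_mult simp del: of_real_mult)
    moreover have "integrable M (\<lambda>\<omega>. \<Prod>i\<in>I. indicator (A i) (Y i \<omega>) :: complex)"
      using ind by (intro integrable_const_bound[where B = 1]) auto
    ultimately show ?thesis
      unfolding left_diff_distrib by (subst (asm) Bochner_Integration.integral_diff) (auto simp: c_def)
  qed
  have ev: "?P \<subseteq> events" "?Q \<subseteq> events"
    using assms(1) by (auto intro!: sets.sets_Collect_finite_All)
  have "indep_set ?P ?Q"
  proof (rule indep_setI[OF ev])
    fix a b assume "a \<in> ?P" "b \<in> ?Q"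
    then obtain A B where a: "a = {\<omega> \<in> space M. \<forall>i\<in>I. Y i \<omega> \<in> A i}" and A [measurable]: "\<And>i. i \<in> I \<Longrightarrow> A i \<in> sets borel"
      and b: "b = Z -` B \<inter> space M" and [measurable]: "B \<in> sets borel"
      by auto
    have [measurable]: "a \<in> events" "b \<in> events"
      using ev \<open>a \<in> ?P\<close> \<open>b \<in> ?Q\<close> by auto
    have ind: "(\<Prod>i\<in>I. indicator (A i) (Y i \<omega>) :: complex) = indicator a \<omega>" if "\<omega> \<in> space M" for \<omega>
      using that assms(1) by (auto simp: a indicator_def intro!: prod_zero)
    have ia: "(CLINT \<omega>|M. indicator a \<omega>) = complex_of_real (prob a)"
      using integral_complex_of_real[of M "indicator a"] by (simp add: of_real_indicator)
    have rect': "(CLINT \<omega>|M. iexp (s * Z \<omega>) * indicator a \<omega>) = (CLINT \<omega>|M. iexp (s * Z \<omega>)) * prob a" for s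
      using rect[of A s, OF A] ind by (simp add: ia cong: Bochner_Integration.integral_cong)
    \<comment> \<open>The same centring with the roles exchanged: the event \<open>a\<close> is now
      the weight and \<open>Z\<close> carries the exponentials.\<close>
    have "(LINT \<omega>|M. (indicator a \<omega> - prob a) * indicator B (Z \<omega>)) = 0"
    proof (rule fourier_vanish_real[where C = 1])
      show "\<bar>indicator a \<omega> - prob a\<bar> \<le> 1" for \<omega>
        using measure_nonneg[of M a] prob_le_1[of a] by (auto simp: indicator_def)
      fix s
      have "integrable M (\<lambda>\<omega>. iexp (s * Z \<omega>) * indicator a \<omega>)"
        by (intro integrable_const_bound[where B = 1]) (auto simp: norm_mult indicator_def simp del: of_real_mult)
      moreover have "integrable M (\<lambda>\<omega>. iexp (s * Z \<omega>))"
        by (intro integrable_const_bound[where B = 1]) (auto simp del: of_real_mult)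
      ultimately have "(CLINT \<omega>|M. iexp (s * Z \<omega>) * indicator a \<omega> - iexp (s * Z \<omega>) * prob a) = 0"
        using rect'[of s] by (subst Bochner_Integration.integral_diff) auto
      then show "(CLINT \<omega>|M. (indicator a \<omega> - prob a) * iexp (s * Z \<omega>)) = 0"
        by (simp add: algebra_simps of_real_indicator)
    qed auto
    moreover have "(indicator a \<omega> - prob a) * indicator B (Z \<omega>) = indicator (a \<inter> b) \<omega> - prob a * indicator b \<omega>"
      if "\<omega> \<in> space M" for \<omega>
      using that by (auto simp: b indicator_def)
    ultimately have "(LINT \<omega>|M. indicator (a \<inter> b) \<omega> - prob a * indicator b \<omega>) = 0"
      by (simp cong: Bochner_Integration.integral_cong)
    moreover have "integrable M (indicator (a \<inter> b) :: 'a \<Rightarrow> real)" "integrable M (indicator b :: 'a \<Rightarrow> real)"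
      by (auto intro!: integrable_const_bound[where B = 1])
    ultimately show "prob (a \<inter> b) = prob a * prob b"
      by (subst (asm) Bochner_Integration.integral_diff) auto
  qed
  moreover have "Int_stable ?P"
  proof (rule Int_stableI)
    fix a b assume "a \<in> ?P" "b \<in> ?P"
    then obtain A B where a: "a = {\<omega> \<in> space M. \<forall>i\<in>I. Y i \<omega> \<in> A i}" and A: "\<forall>i\<in>I. A i \<in> sets borel"
      and b: "b = {\<omega> \<in> space M. \<forall>i\<in>I. Y i \<omega> \<in> B i}" and B: "\<forall>i\<in>I. B i \<in> sets borel" by auto
    have "a \<inter> b = {\<omega> \<in> space M. \<forall>i\<in>I. Y i \<omega> \<in> A i \<inter> B i}" by (auto simp: a b)
    moreover have "\<forall>i\<in>I. A i \<inter> B i \<in> sets borel" using A B by auto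
    ultimately show "a \<inter> b \<in> ?P"
      by (intro CollectI exI[of _ "\<lambda>i. A i \<inter> B i"] conjI)
  qed
  moreover have "Int_stable ?Q"
  proof (rule Int_stableI)
    fix a b assume "a \<in> ?Q" "b \<in> ?Q"
    then obtain A B where a: "a = Z -` A \<inter> space M" and A: "A \<in> sets borel"
      and b: "b = Z -` B \<inter> space M" and B: "B \<in> sets borel"
      by auto
    have "a \<inter> b = Z -` (A \<inter> B) \<inter> space M" by (auto simp: a b)
    moreover have "A \<inter> B \<in> sets borel" using A B by auto
    ultimately show "a \<inter> b \<in> ?Q"
      by (intro CollectI exI[of _ "A \<inter> B"] conjI)
  qed
  ultimately have "indep_set (sigma_sets (space M) ?P) (sigma_sets (space M) ?Q)"
    by (rule indep_set_sigma_sets)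
  then show ?thesis
    unfolding sets_generated_algebra_finite[OF assms(1)] sets_vimage_algebra .
qed

end

section \<open>Conditioning on an independent sigma-algebra\<close>

context prob_space
begin

lemma indep_var_of_indep_set:
  fixes X Z :: "'a \<Rightarrow> real"
  assumes indep: "indep_set (sets F) (sets G)"
    and sp: "space F = space M" "space G = space M"
    and X: "X \<in> borel_measurable F" and Z: "Z \<in> borel_measurable G"
  shows "indep_var borel X borel Z"
proof -
  have sub: "subalgebra M F" "subalgebra M G"
    using indep_setD_ev1[OF indep] indep_setD_ev2[OF indep] sp by (auto simp: subalgebra_def)
  have "sigma_sets (space M) {X -` A \<inter> space M |A. A \<in> sets borel} \<subseteq> sets F"
    using sets.sigma_sets_subset[of "{X -` A \<inter> space M |A. A \<in> sets borel}" F] measurable_sets[OF X]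
    by (auto simp: sp)
  moreover have "sigma_sets (space M) {Z -` A \<inter> space M |A. A \<in> sets borel} \<subseteq> sets G"
    using sets.sigma_sets_subset[of "{Z -` A \<inter> space M |A. A \<in> sets borel}" G] measurable_sets[OF Z]
    by (auto simp: sp)
  ultimately have "indep_set (sigma_sets (space M) {X -` A \<inter> space M |A. A \<in> sets borel})
      (sigma_sets (space M) {Z -` A \<inter> space M |A. A \<in> sets borel})"
    using indep unfolding indep_sets2_eq by blast
  then show ?thesis
    unfolding indep_var_eq using measurable_from_subalg[OF sub(1) X] measurable_from_subalg[OF sub(2) Z] by simp
qed

lemma finite_measure_subalgebraI:
  assumes "subalgebra M F"
  shows "finite_measure_subalgebra M F"
  using assms finite_measure_axioms
  by (simp add: finite_measure_subalgebra_def finite_measure_subalgebra_axioms_def)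

text \<open>Against the indicator of an event of \<open>F\<close>, independence factors the integral
  of \<open>Z\<close>, and the constant \<open>expectation Z\<close> yields the same
  product.\<close>

lemma real_cond_exp_indep:
  fixes Z :: "'a \<Rightarrow> real"
  assumes sub: "subalgebra M F" and indep: "indep_set (sets F) (sets G)"
    and sp: "space G = space M" and Z: "Z \<in> borel_measurable G" and int: "integrable M Z"
  shows "AE \<omega> in M. real_cond_exp M F Z \<omega> = expectation Z"
proof -
  interpret finite_measure_subalgebra M F by (rule finite_measure_subalgebraI[OF sub])
  show ?thesis
  proof (rule real_cond_exp_charact)
    fix A assume A [measurable]: "A \<in> sets F"
    then have AM [measurable]: "A \<in> sets M" using sub by (auto simp: subalgebra_def)
    have "indep_var borel (indicator A) borel Z"
      using sub by (intro indep_var_of_indep_set[OF indep]) (auto simp: sp Z subalgebra_def)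
    moreover have "integrable M (indicator A :: 'a \<Rightarrow> real)"
      by (intro integrable_const_bound[where B = 1]) auto
    ultimately have "(LINT \<omega>|M. indicator A \<omega> * Z \<omega>) = prob A * expectation Z"
      using int by (subst indep_var_lebesgue_integral) auto
    then show "(LINT \<omega>:A|M. Z \<omega>) = (LINT \<omega>:A|M. expectation Z)"
      by (simp add: set_lebesgue_integral_def)
  qed (use int in auto)
qed

text \<open>The sample point itself is treated as a random element with values in the coarser space
  \<open>F\<close>. Independence of \<open>Z\<close> from \<open>F\<close> then says that the joint
  law of sample point and \<open>Z\<close> is a product, which opens the way to Fubini.\<close>

lemma distr_pair_indep:
  fixes Z :: "'a \<Rightarrow> real"
  assumes sub: "subalgebra M F" and Z [measurable]: "Z \<in> borel_measurable M"
    and indep: "indep_set (sets F) (sets (vimage_algebra (space M) Z borel))"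
  shows "restr_to_subalg M F \<Otimes>\<^sub>M distr M borel Z = distr M (F \<Otimes>\<^sub>M borel) (\<lambda>\<omega>. (\<omega>, Z \<omega>))"
proof (rule pair_measure_eqI)
  have id [measurable]: "(\<lambda>\<omega>. \<omega>) \<in> measurable M F"
    using sub by (auto simp: subalgebra_def measurable_def sets.sets_into_space Int_absorb2)
  show "sigma_finite_measure (restr_to_subalg M F)"
    using prob_space_restr_to_subalg[OF sub prob_space_axioms] by (simp add: prob_space_imp_sigma_finite)
  show "sigma_finite_measure (distr M borel Z)"
    by (simp add: prob_space_distr prob_space_imp_sigma_finite)
  show "sets (restr_to_subalg M F \<Otimes>\<^sub>M distr M borel Z) = sets (distr M (F \<Otimes>\<^sub>M borel) (\<lambda>\<omega>. (\<omega>, Z \<omega>)))"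
    using sets_restr_to_subalg[OF sub] by (simp cong: sets_pair_measure_cong)
  fix A B assume "A \<in> sets (restr_to_subalg M F)" and B: "B \<in> sets (distr M borel Z)"
  then have A [measurable]: "A \<in> sets F" and [measurable]: "B \<in> sets borel"
    using sets_restr_to_subalg[OF sub] by auto
  have [measurable]: "A \<in> sets M" using A sub by (auto simp: subalgebra_def)
  have "(\<lambda>\<omega>. (\<omega>, Z \<omega>)) -` (A \<times> B) \<inter> space M = A \<inter> (Z -` B \<inter> space M)" by auto
  moreover have "prob (A \<inter> (Z -` B \<inter> space M)) = prob A * prob (Z -` B \<inter> space M)"
    by (rule indep_setD[OF indep A]) (auto intro: in_vimage_algebra)
  ultimately show "emeasure (restr_to_subalg M F) A * emeasure (distr M borel Z) B =
      emeasure (distr M (F \<Otimes>\<^sub>M borel) (\<lambda>\<omega>. (\<omega>, Z \<omega>))) (A \<times> B)"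
    by (simp add: emeasure_restr_to_subalg[OF sub A] emeasure_distr emeasure_eq_measure ennreal_mult)
qed

text \<open>By Fubini, the value of \<open>L\<close> can be frozen while \<open>Z\<close> is
  integrated over its own law; the inner integral is the mass that the shifted law of
  \<open>Z\<close> gives to \<open>A\<close>.\<close>

lemma cond_distribution_add_indep:
  fixes L Z :: "'a \<Rightarrow> real"
  assumes sub: "subalgebra M F" and L [measurable]: "L \<in> borel_measurable F"
    and Z [measurable]: "Z \<in> borel_measurable M"
    and indep: "indep_set (sets F) (sets (vimage_algebra (space M) Z borel))"
  shows "cond_distribution M F (\<lambda>\<omega>. L \<omega> + Z \<omega>) (\<lambda>\<omega>. distr (distr M borel Z) borel (\<lambda>z. L \<omega> + z))"
    (is "cond_distribution M F ?U ?K")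
  unfolding cond_distribution_def
proof (intro conjI ballI)
  interpret finite_measure_subalgebra M F by (rule finite_measure_subalgebraI[OF sub])
  let ?N = "distr M borel Z"
  interpret N: prob_space ?N by (rule prob_space_distr) simp
  interpret R: prob_space "restr_to_subalg M F"
    using prob_space_restr_to_subalg[OF sub prob_space_axioms] .
  interpret RN: pair_prob_space "restr_to_subalg M F" ?N ..
  have LM [measurable]: "L \<in> borel_measurable M" by (rule measurable_from_subalg[OF sub L])
  have id [measurable]: "(\<lambda>\<omega>. \<omega>) \<in> measurable M F"
    using sub by (auto simp: subalgebra_def measurable_def sets.sets_into_space Int_absorb2)
  show K: "?K \<in> measurable F (prob_algebra borel)"
    by (rule measurable_distr_prob_space2[where M = borel])
      (auto intro!: measurable_const simp: space_prob_algebra N.prob_space_axioms)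
  fix A :: "real set" assume A [measurable]: "A \<in> sets borel"
  have mK [measurable]: "(\<lambda>\<omega>. measure (?K \<omega>) A) \<in> borel_measurable F"
    by (rule measurable_compose[OF K measurable_measure_prob_algebra[OF A]])
  have mKM [measurable]: "(\<lambda>\<omega>. measure (?K \<omega>) A) \<in> borel_measurable M"
    by (rule measurable_from_subalg[OF sub mK])
  have K1: "measure (?K \<omega>) A \<le> 1" for \<omega>
    by (intro prob_space.prob_le_1 N.prob_space_distr) simp
  have "AE \<omega> in M. real_cond_exp M F (indicator (?U -` A \<inter> space M)) \<omega> = measure (?K \<omega>) A"
  proof (rule real_cond_exp_charact)
    show "integrable M (indicator (?U -` A \<inter> space M) :: 'a \<Rightarrow> real)"
      by (intro integrable_const_bound[where B = 1]) auto
    show "integrable M (\<lambda>\<omega>. measure (?K \<omega>) A)"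
      using K1 by (intro integrable_const_bound[where B = 1]) auto
    fix B assume B [measurable]: "B \<in> sets F"
    then have [measurable]: "B \<in> sets M" using sub by (auto simp: subalgebra_def)
    \<comment> \<open>Measurability of \<open>L\<close> with respect to \<open>F\<close>, not merely
      \<open>M\<close>, makes \<open>h\<close> measurable on the product with the coarse
      space.\<close>
    define h where "h = (\<lambda>(\<omega>, z). indicator B \<omega> * indicator A (L \<omega> + z) :: real)"
    have h [measurable]: "h \<in> borel_measurable (F \<Otimes>\<^sub>M borel)"
      unfolding h_def by measurable
    have sets_eq: "sets (restr_to_subalg M F \<Otimes>\<^sub>M ?N) = sets (F \<Otimes>\<^sub>M borel)"
      using sets_restr_to_subalg[OF sub] by (simp cong: sets_pair_measure_cong)
    have h' [measurable]: "h \<in> borel_measurable (restr_to_subalg M F \<Otimes>\<^sub>M ?N)"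
      using h measurable_cong_sets[OF sets_eq refl] by blast
    have inth: "integrable (restr_to_subalg M F \<Otimes>\<^sub>M ?N) h"
      by (rule RN.integrable_const_bound[where B = 1, OF _ h']) (auto simp: h_def indicator_def)
    have "(LINT \<omega>:B|M. indicator (?U -` A \<inter> space M) \<omega>) = (LINT \<omega>|M. h (\<omega>, Z \<omega>))"
      unfolding set_lebesgue_integral_def
      by (intro Bochner_Integration.integral_cong) (auto simp: h_def indicator_def)
    also have "\<dots> = integral\<^sup>L (restr_to_subalg M F \<Otimes>\<^sub>M ?N) h"
      unfolding distr_pair_indep[OF sub Z indep] by (subst integral_distr) auto
    also have "\<dots> = (LINT \<omega>|restr_to_subalg M F. LINT z|?N. h (\<omega>, z))"
      by (rule RN.integral_fst'[OF inth, symmetric])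
    also have "\<dots> = (LINT \<omega>|restr_to_subalg M F. indicator B \<omega> * measure (?K \<omega>) A)"
    proof (rule Bochner_Integration.integral_cong[OF refl])
      fix \<omega>
      have "(LINT z|?N. h (\<omega>, z)) = indicator B \<omega> * (LINT z|?N. indicator A (L \<omega> + z))"
        by (simp add: h_def)
      also have "(LINT z|?N. indicator A (L \<omega> + z)) = integral\<^sup>L (?K \<omega>) (indicator A :: real \<Rightarrow> real)"
        by (subst (2) integral_distr) auto
      also have "\<dots> = measure (?K \<omega>) A" by simp
      finally show "(LINT z|?N. h (\<omega>, z)) = indicator B \<omega> * measure (?K \<omega>) A" .
    qed
    also have "\<dots> = (LINT \<omega>|M. indicator B \<omega> * measure (?K \<omega>) A)"
      by (rule integral_subalgebra2[OF sub]) simp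
    finally show "(LINT \<omega>:B|M. indicator (?U -` A \<inter> space M) \<omega>) = (LINT \<omega>:B|M. measure (?K \<omega>) A)"
      by (simp add: set_lebesgue_integral_def)
  qed simp
  then show "AE \<omega> in M. measure (?K \<omega>) A = real_cond_exp M F (indicator (?U -` A \<inter> space M)) \<omega>"
    by (auto simp: eq_commute)
qed

end

section \<open>Gaussian spaces\<close>

definition (in prob_space) cov :: "('a \<Rightarrow> real) \<Rightarrow> ('a \<Rightarrow> real) \<Rightarrow> real" where
  "cov X Y = expectation (\<lambda>\<omega>. X \<omega> * Y \<omega>) - expectation X * expectation Y"

text \<open>Closure under linear combinations makes joint Gaussianity of any finite family a
  property of single members. Constants belong to \<open>S\<close> so that regressions may have an
  intercept; they are Gaussian because degenerate laws count.\<close>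

locale gaussian_space = prob_space M for M :: "'a measure" +
  fixes S :: "('a \<Rightarrow> real) set"
  assumes meas: "X \<in> S \<Longrightarrow> X \<in> borel_measurable M"
    and gaussian: "X \<in> S \<Longrightarrow> gaussian_measure (distr M borel X)"
    and add: "X \<in> S \<Longrightarrow> Y \<in> S \<Longrightarrow> (\<lambda>\<omega>. X \<omega> + Y \<omega>) \<in> S"
    and scale: "X \<in> S \<Longrightarrow> (\<lambda>\<omega>. c * X \<omega>) \<in> S"
    and const: "(\<lambda>\<omega>. c) \<in> S"
begin

lemma diff: "X \<in> S \<Longrightarrow> Y \<in> S \<Longrightarrow> (\<lambda>\<omega>. X \<omega> - Y \<omega>) \<in> S"
  using add[OF _ scale[of Y "-1"], of X] by simp

lemma sum:
  assumes "finite I" "\<And>i. i \<in> I \<Longrightarrow> X i \<in> S"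
  shows "(\<lambda>\<omega>. \<Sum>i\<in>I. t i * X i \<omega>) \<in> S"
  using assms
proof (induction I rule: finite_induct)
  case (insert i I)
  then show ?case by (simp add: add[OF scale])
qed (simp add: const)

lemma integrable: "X \<in> S \<Longrightarrow> integrable M X"
  using gaussian_integrable[OF meas gaussian] .

lemma integrable_mult:
  assumes "X \<in> S" "Y \<in> S"
  shows "integrable M (\<lambda>\<omega>. X \<omega> * Y \<omega>)"
proof -
  note [measurable] = meas[OF assms(1)] meas[OF assms(2)]
  have "integrable M (\<lambda>\<omega>. (X \<omega>)\<^sup>2 + (Y \<omega>)\<^sup>2)"
    using gaussian_square_integrable[OF meas gaussian] assms by auto
  then show ?thesis
  proof (rule Bochner_Integration.integrable_bound)
    have "\<bar>x * y\<bar> \<le> x\<^sup>2 + y\<^sup>2" for x y :: real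
      using sum_squares_bound[of "\<bar>x\<bar>" "\<bar>y\<bar>"] abs_ge_zero[of "x * y"]
      unfolding abs_mult power2_abs by linarith
    then show "AE \<omega> in M. norm (X \<omega> * Y \<omega>) \<le> norm ((X \<omega>)\<^sup>2 + (Y \<omega>)\<^sup>2)"
      by simp
  qed simp
qed

lemma cov_commute: "cov X Y = cov Y X"
  by (simp add: cov_def mult.commute)

lemma cov_const: "X \<in> S \<Longrightarrow> cov X (\<lambda>\<omega>. c) = 0"
  using integrable[of X] by (simp add: cov_def prob_space)

lemma cov_add:
  assumes "X \<in> S" "Y \<in> S" "Z \<in> S"
  shows "cov X (\<lambda>\<omega>. Y \<omega> + Z \<omega>) = cov X Y + cov X Z"
  using assms integrable integrable_mult[of X Y] integrable_mult[of X Z]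
  by (simp add: cov_def distrib_left)

lemma cov_scale: "cov X (\<lambda>\<omega>. c * Y \<omega>) = c * cov X Y"
  by (simp add: cov_def mult.left_commute[of _ c] right_diff_distrib)

lemma cov_diff:
  assumes "X \<in> S" "Y \<in> S" "Z \<in> S"
  shows "cov X (\<lambda>\<omega>. Y \<omega> - Z \<omega>) = cov X Y - cov X Z"
  using assms integrable integrable_mult[of X Y] integrable_mult[of X Z]
  by (simp add: cov_def right_diff_distrib)

lemma cov_sum:
  assumes "finite I" "X \<in> S" "\<And>i. i \<in> I \<Longrightarrow> Y i \<in> S"
  shows "cov X (\<lambda>\<omega>. \<Sum>i\<in>I. t i * Y i \<omega>) = (\<Sum>i\<in>I. t i * cov X (Y i))"
  using assms(1,3)
proof (induction I rule: finite_induct)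
  case empty
  then show ?case using cov_const[OF assms(2), of 0] by simp
next
  case (insert i I)
  then show ?case using assms(2) by (simp add: cov_add cov_scale sum scale)
qed

lemma cov_self: "X \<in> S \<Longrightarrow> cov X X = variance X"
  using variance_eq[OF integrable gaussian_square_integrable[OF meas gaussian], of X]
  by (simp add: cov_def power2_eq_square)

lemma cov_self_nonneg: "X \<in> S \<Longrightarrow> 0 \<le> cov X X"
  by (simp add: cov_self)

lemma cov_add_self:
  assumes "X \<in> S" "Y \<in> S"
  shows "cov (\<lambda>\<omega>. X \<omega> + Y \<omega>) (\<lambda>\<omega>. X \<omega> + Y \<omega>) = cov X X + 2 * cov X Y + cov Y Y"
proof -
  have *: "(\<lambda>\<omega>. X \<omega> + Y \<omega>) \<in> S" using assms by (rule add)
  show ?thesis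
    unfolding cov_add[OF * assms] cov_commute[of "\<lambda>\<omega>. X \<omega> + Y \<omega>"]
    using assms by (simp add: cov_add cov_commute[of Y X])
qed

lemma cov_diff_self:
  assumes "X \<in> S" "Y \<in> S"
  shows "cov (\<lambda>\<omega>. X \<omega> - Y \<omega>) (\<lambda>\<omega>. X \<omega> - Y \<omega>) = cov X X - 2 * cov X Y + cov Y Y"
proof -
  have *: "(\<lambda>\<omega>. X \<omega> - Y \<omega>) \<in> S" using assms by (rule diff)
  show ?thesis
    unfolding cov_diff[OF * assms] cov_commute[of "\<lambda>\<omega>. X \<omega> - Y \<omega>"]
    using assms by (simp add: cov_diff cov_commute[of Y X])
qed

text \<open>The degenerate case of Cauchy-Schwarz: if \<open>cov Y Y = 0\<close>, the variance of
  \<open>X + t * Y\<close> is affine in \<open>t\<close> and bounded below by 0, so its slope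
  vanishes.\<close>

lemma cov_eq_0:
  assumes X: "X \<in> S" and Y: "Y \<in> S" and "cov Y Y = 0"
  shows "cov X Y = 0"
proof (rule ccontr)
  assume c: "cov X Y \<noteq> 0"
  \<comment> \<open>Solves \<open>cov X X + 2 * t * cov X Y = -1\<close>.\<close>
  define t where "t = - (cov X X + 1) / (2 * cov X Y)"
  have "0 \<le> cov (\<lambda>\<omega>. X \<omega> + t * Y \<omega>) (\<lambda>\<omega>. X \<omega> + t * Y \<omega>)"
    using assms by (intro cov_self_nonneg add scale)
  also have "\<dots> = cov X X + 2 * t * cov X Y"
    using assms by (simp add: cov_add_self scale cov_scale cov_commute[of "\<lambda>\<omega>. t * Y \<omega>"])
  also have "\<dots> = -1" using c by (simp add: t_def field_simps)
  finally show False by simp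
qed

text \<open>Gram-Schmidt without normalization. The new observation \<open>Y k\<close> is first
  cleared of its regression on the earlier ones, and \<open>U\<close> is then corrected along what
  remains. No covariance matrix is inverted, so linearly dependent observations are allowed.\<close>

lemma exists_residual:
  assumes "finite I" "\<And>i. i \<in> I \<Longrightarrow> Y i \<in> S" "U \<in> S"
  shows "\<exists>a. \<forall>j\<in>I. cov (\<lambda>\<omega>. U \<omega> - (\<Sum>i\<in>I. a i * Y i \<omega>)) (Y j) = 0"
  using assms
proof (induction I arbitrary: U rule: finite_induct)
  case empty
  then show ?case by simp
next
  case (insert k I)
  have YS: "Y i \<in> S" if "i \<in> insert k I" for i using that insert.prems by auto
  obtain a where a: "\<And>j. j \<in> I \<Longrightarrow> cov (\<lambda>\<omega>. U \<omega> - (\<Sum>i\<in>I. a i * Y i \<omega>)) (Y j) = 0"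
    using insert.IH[of U] insert.prems by auto
  obtain b where b: "\<And>j. j \<in> I \<Longrightarrow> cov (\<lambda>\<omega>. Y k \<omega> - (\<Sum>i\<in>I. b i * Y i \<omega>)) (Y j) = 0"
    using insert.IH[of "Y k"] insert.prems by auto
  define U' where "U' = (\<lambda>\<omega>. U \<omega> - (\<Sum>i\<in>I. a i * Y i \<omega>))"
  define V' where "V' = (\<lambda>\<omega>. Y k \<omega> - (\<Sum>i\<in>I. b i * Y i \<omega>))"
  \<comment> \<open>If \<open>Y k\<close> brings nothing new, then \<open>cov V' V' = 0\<close>, the
    quotient is 0 by convention, and no correction is made. In that case
    \<open>cov U' V' = 0\<close> already holds by the degenerate Cauchy-Schwarz case.\<close>
  define c where "c = cov U' V' / cov V' V'"
  define R where "R = (\<lambda>\<omega>. U' \<omega> - c * V' \<omega>)"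
  have S: "U' \<in> S" "V' \<in> S"
    unfolding U'_def V'_def using insert by (auto intro!: diff sum)
  then have RS: "R \<in> S" unfolding R_def by (auto intro!: diff scale)
  have covR: "cov R X = cov U' X - c * cov V' X" if "X \<in> S" for X
    unfolding R_def using that S
    by (simp add: cov_commute[of _ X] cov_diff scale cov_scale)
  have RI: "cov R (Y j) = 0" if "j \<in> I" for j
    using covR[OF YS, of j] a[OF that] b[OF that] that by (simp add: U'_def V'_def)
  have RV: "cov R V' = 0"
    using covR[OF S(2)] cov_eq_0[OF S] by (cases "cov V' V' = 0") (auto simp: c_def)
  \<comment> \<open>\<open>V'\<close> differs from \<open>Y k\<close> by a combination of earlier
    observations, with which \<open>R\<close> is already uncorrelated.\<close>
  have "cov R V' = cov R (Y k) - (\<Sum>i\<in>I. b i * cov R (Y i))"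
    unfolding V'_def using insert.hyps RS YS by (subst cov_diff) (auto intro: sum simp: cov_sum)
  then have Rk: "cov R (Y k) = 0" using RV RI by simp
  have "R = (\<lambda>\<omega>. U \<omega> - (\<Sum>i\<in>insert k I. (if i = k then c else a i - c * b i) * Y i \<omega>))"
  proof
    fix \<omega>
    have "(\<Sum>i\<in>I. (if i = k then c else a i - c * b i) * Y i \<omega>)
        = (\<Sum>i\<in>I. a i * Y i \<omega> - c * (b i * Y i \<omega>))"
      using insert.hyps by (intro sum.cong) (auto simp: algebra_simps)
    also have "\<dots> = (\<Sum>i\<in>I. a i * Y i \<omega>) - c * (\<Sum>i\<in>I. b i * Y i \<omega>)"
      by (simp add: sum_subtractf sum_distrib_left)
    finally show "R \<omega> = U \<omega> - (\<Sum>i\<in>insert k I. (if i = k then c else a i - c * b i) * Y i \<omega>)"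
      using insert.hyps by (simp add: R_def U'_def V'_def algebra_simps)
  qed
  moreover have "\<forall>j\<in>insert k I. cov R (Y j) = 0" using RI Rk by blast
  ultimately have "\<forall>j\<in>insert k I. cov (\<lambda>\<omega>. U \<omega> - (\<Sum>i\<in>insert k I. (if i = k then c else a i - c * b i) * Y i \<omega>)) (Y j) = 0"
    by (simp only:)
  then show ?case by (rule exI[of _ "\<lambda>i. if i = k then c else a i - c * b i"])
qed

text \<open>The argument 1 suffices: since \<open>S\<close> is closed under scaling and sums, all
  frequencies can be absorbed into the variable.\<close>

lemma char_at_1:
  assumes "X \<in> S"
  shows "(CLINT \<omega>|M. iexp (X \<omega>)) = iexp (expectation X) * exp (- cov X X / 2)"
proof -
  note [measurable] = meas[OF assms]
  have "(CLINT \<omega>|M. iexp (X \<omega>)) = char (distr M borel X) 1"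
    unfolding char_def by (simp add: integral_distr)
  then show ?thesis
    using gaussian_char[OF meas gaussian, OF assms assms, of 1] by (simp add: cov_self[OF assms])
qed

text \<open>The characteristic function of a member depends only on its mean and variance. Zero
  covariance makes the variance of \<open>s * Z\<close> plus a combination of the \<open>Y i\<close>
  additive, so the joint characteristic function factorizes.\<close>

lemma uncorrelated_imp_indep:
  assumes "finite I" and Y: "\<And>i. i \<in> I \<Longrightarrow> Y i \<in> S" and Z: "Z \<in> S"
    and uncor: "\<And>i. i \<in> I \<Longrightarrow> cov Z (Y i) = 0"
  shows "indep_set (sets (generated_algebra M I Y)) (sets (vimage_algebra (space M) Z borel))"
proof (rule indep_of_char[OF assms(1)])
  fix s :: real and t :: "'b \<Rightarrow> real"
  define T where "T = (\<lambda>\<omega>. \<Sum>i\<in>I. t i * Y i \<omega>)"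
  define X where "X = (\<lambda>\<omega>. s * Z \<omega>)"
  have S: "T \<in> S" "X \<in> S"
    unfolding T_def X_def using assms by (auto intro: sum scale)
  have "cov X T = 0"
    unfolding X_def cov_commute[of _ T] cov_scale unfolding T_def cov_commute[of _ Z]
    using assms by (simp add: cov_sum)
  then have cov: "cov (\<lambda>\<omega>. X \<omega> + T \<omega>) (\<lambda>\<omega>. X \<omega> + T \<omega>) = cov X X + cov T T"
    using S by (simp add: cov_add_self)
  have E: "expectation (\<lambda>\<omega>. X \<omega> + T \<omega>) = expectation X + expectation T"
    using S integrable by simp
  have "(CLINT \<omega>|M. iexp (X \<omega>) * iexp (T \<omega>)) = (CLINT \<omega>|M. iexp (X \<omega> + T \<omega>))"
    by (simp add: distrib_left exp_add)
  also have "\<dots> = iexp (expectation X + expectation T) * exp (- (cov X X + cov T T) / 2)"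
    unfolding char_at_1[OF add[OF S(2,1)]] cov E ..
  also have "iexp (expectation X + expectation T) = iexp (expectation X) * iexp (expectation T)"
    by (simp add: distrib_left exp_add)
  also have "exp (- (cov X X + cov T T) / 2) = exp (- cov X X / 2) * exp (- cov T T / 2)"
    by (simp add: exp_add[symmetric] add_divide_distrib)
  also have "iexp (expectation X) * iexp (expectation T) * complex_of_real (exp (- cov X X / 2) * exp (- cov T T / 2))
      = (CLINT \<omega>|M. iexp (X \<omega>)) * (CLINT \<omega>|M. iexp (T \<omega>))"
    unfolding char_at_1[OF S(1)] char_at_1[OF S(2)] of_real_mult by (simp only: mult_ac)
  finally show "(CLINT \<omega>|M. iexp (s * Z \<omega>) * iexp (\<Sum>i\<in>I. t i * Y i \<omega>)) =
      (CLINT \<omega>|M. iexp (s * Z \<omega>)) * (CLINT \<omega>|M. iexp (\<Sum>i\<in>I. t i * Y i \<omega>))"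
    by (simp only: X_def T_def)
qed (use meas Y Z in auto)

end

section \<open>Conditioning in Gaussian spaces\<close>

lemma measurable_generated_algebra:
  assumes "i \<in> I"
  shows "Y i \<in> borel_measurable (generated_algebra M I Y)"
proof -
  have "(\<lambda>\<omega>. \<lambda>i\<in>I. Y i \<omega>) \<in> measurable (generated_algebra M I Y) (PiM I (\<lambda>_. borel))"
    unfolding generated_algebra_def by (rule measurable_vimage_algebra1) (auto simp: space_PiM)
  from measurable_compose[OF this measurable_component_singleton[OF assms]] assms
  show ?thesis by simp
qed

lemma space_generated_algebra [simp]: "space (generated_algebra M I Y) = space M"
  by (simp add: generated_algebra_def)

locale gaussian_data = gaussian_space +
  fixes I :: "'i set" and Y :: "'i \<Rightarrow> 'a \<Rightarrow> real" and D :: "'a measure"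
  assumes finite_I: "finite I" and Y_in: "i \<in> I \<Longrightarrow> Y i \<in> S"
    and D_def: "D = generated_algebra M I Y"
begin

text \<open>The orthogonal complement, for the second-moment inner product, of the constants and the
  data within \<open>S\<close>. It is a linear space, so combinations of regression errors remain
  independent of \<open>D\<close>.\<close>

definition residual :: "('a \<Rightarrow> real) \<Rightarrow> bool" where
  "residual Z \<longleftrightarrow> Z \<in> S \<and> expectation Z = 0 \<and> (\<forall>i\<in>I. cov Z (Y i) = 0)"

lemma residual_in: "residual Z \<Longrightarrow> Z \<in> S"
  by (simp add: residual_def)

lemma residual_add: "residual Z \<Longrightarrow> residual Z' \<Longrightarrow> residual (\<lambda>\<omega>. Z \<omega> + Z' \<omega>)"
  using Y_in by (simp add: residual_def add integrable cov_commute[of _ "Y _"] cov_add)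

lemma residual_scale: "residual Z \<Longrightarrow> residual (\<lambda>\<omega>. c * Z \<omega>)"
  by (simp add: residual_def scale cov_commute[of _ "Y _"] cov_scale)

lemma subalgebra_D: "subalgebra M D"
proof -
  have "(\<lambda>\<omega>. \<lambda>i\<in>I. Y i \<omega>) \<in> measurable M (PiM I (\<lambda>_. borel))"
    using meas[OF Y_in] by (intro measurable_restrict) auto
  then show ?thesis
    unfolding D_def subalgebra_def generated_algebra_def
    using sets_image_in_sets[of M "space M"] by simp
qed

lemma Y_measurable: "i \<in> I \<Longrightarrow> Y i \<in> borel_measurable D"
  unfolding D_def by (rule measurable_generated_algebra)

lemma residual_indep:
  "residual Z \<Longrightarrow> indep_set (sets D) (sets (vimage_algebra (space M) Z borel))"
  unfolding D_def by (rule uncorrelated_imp_indep[OF finite_I Y_in]) (auto simp: residual_def)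

lemma residual_measurable_generated: "Z \<in> borel_measurable (vimage_algebra (space M) Z borel)"
  by (rule measurable_vimage_algebra1) simp

lemma cond_exp_residual:
  assumes "residual Z"
  shows "AE \<omega> in M. real_cond_exp M D Z \<omega> = 0"
  using real_cond_exp_indep[OF subalgebra_D residual_indep[OF assms] _ residual_measurable_generated]
    integrable[of Z] assms by (simp add: residual_def)

lemma cond_exp_residual_square:
  assumes "residual Z"
  shows "AE \<omega> in M. real_cond_exp M D (\<lambda>\<omega>. Z \<omega> * Z \<omega>) \<omega> = cov Z Z"
proof -
  note [measurable] = residual_measurable_generated[of Z]
  have "AE \<omega> in M. real_cond_exp M D (\<lambda>\<omega>. Z \<omega> * Z \<omega>) \<omega> = expectation (\<lambda>\<omega>. Z \<omega> * Z \<omega>)"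
    using assms integrable_mult[of Z Z]
    by (intro real_cond_exp_indep[OF subalgebra_D residual_indep[OF assms]]) (auto simp: residual_def)
  then show ?thesis using assms by (simp add: cov_def residual_def)
qed

text \<open>Polarization reduces products of two residuals to squares of residuals, so that joint
  independence of the pair from \<open>D\<close> is not needed.\<close>

lemma cond_exp_residual_mult:
  assumes Z: "residual Z" and Z': "residual Z'"
  shows "AE \<omega> in M. real_cond_exp M D (\<lambda>\<omega>. Z \<omega> * Z' \<omega>) \<omega> = cov Z Z'"
proof -
  interpret D: finite_measure_subalgebra M D by (rule finite_measure_subalgebraI[OF subalgebra_D])
  define T where "T = (\<lambda>\<omega>. Z \<omega> + Z' \<omega>)"
  have T: "residual T" unfolding T_def by (rule residual_add[OF Z Z'])
  note S = residual_in[OF Z] residual_in[OF Z'] residual_in[OF T]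
  have int: "integrable M (\<lambda>\<omega>. T \<omega> * T \<omega>)" "integrable M (\<lambda>\<omega>. Z \<omega> * Z \<omega>)" "integrable M (\<lambda>\<omega>. Z' \<omega> * Z' \<omega>)"
    using S by (auto intro: integrable_mult)
  have eq: "Z \<omega> * Z' \<omega> = (1/2) * ((T \<omega> * T \<omega> - Z \<omega> * Z \<omega>) - Z' \<omega> * Z' \<omega>)" for \<omega>
    by (simp add: T_def algebra_simps)
  have covT: "cov T T = cov Z Z + 2 * cov Z Z' + cov Z' Z'"
    unfolding T_def by (rule cov_add_self[OF S(1,2)])
  have "AE \<omega> in M. real_cond_exp M D (\<lambda>\<omega>. (1/2) * ((T \<omega> * T \<omega> - Z \<omega> * Z \<omega>) - Z' \<omega> * Z' \<omega>)) \<omega>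
      = (1/2) * real_cond_exp M D (\<lambda>\<omega>. (T \<omega> * T \<omega> - Z \<omega> * Z \<omega>) - Z' \<omega> * Z' \<omega>) \<omega>"
    using int by (intro D.real_cond_exp_cmult) auto
  moreover have "AE \<omega> in M. real_cond_exp M D (\<lambda>\<omega>. (T \<omega> * T \<omega> - Z \<omega> * Z \<omega>) - Z' \<omega> * Z' \<omega>) \<omega>
      = real_cond_exp M D (\<lambda>\<omega>. T \<omega> * T \<omega> - Z \<omega> * Z \<omega>) \<omega> - real_cond_exp M D (\<lambda>\<omega>. Z' \<omega> * Z' \<omega>) \<omega>"
    using int by (intro D.real_cond_exp_diff) auto
  moreover have "AE \<omega> in M. real_cond_exp M D (\<lambda>\<omega>. T \<omega> * T \<omega> - Z \<omega> * Z \<omega>) \<omega>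
      = real_cond_exp M D (\<lambda>\<omega>. T \<omega> * T \<omega>) \<omega> - real_cond_exp M D (\<lambda>\<omega>. Z \<omega> * Z \<omega>) \<omega>"
    using int by (intro D.real_cond_exp_diff) auto
  ultimately show ?thesis
    unfolding eq[symmetric]
    using cond_exp_residual_square[OF T] cond_exp_residual_square[OF Z] cond_exp_residual_square[OF Z']
    by eventually_elim (simp add: covT)
qed

text \<open>\<open>L\<close> is affine in the data with coefficients from the Gram-Schmidt step, and
  the intercept \<open>b\<close> centres the error. The last clause holds because a residual is
  uncorrelated with everything affine in the data; it later transfers uncorrelatedness from a
  variable to its regression error.\<close>

lemma exists_regression:
  assumes U: "U \<in> S"
  shows "\<exists>L Z. L \<in> S \<and> L \<in> borel_measurable D \<and> residual Z \<and> U = (\<lambda>\<omega>. L \<omega> + Z \<omega>) \<and>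
    (\<forall>R. residual R \<longrightarrow> cov R L = 0)"
proof -
  obtain a where a: "\<And>j. j \<in> I \<Longrightarrow> cov (\<lambda>\<omega>. U \<omega> - (\<Sum>i\<in>I. a i * Y i \<omega>)) (Y j) = 0"
    using exists_residual[where Y = Y, OF finite_I Y_in U] by blast
  define T where "T = (\<lambda>\<omega>. \<Sum>i\<in>I. a i * Y i \<omega>)"
  define b where "b = expectation (\<lambda>\<omega>. U \<omega> - T \<omega>)"
  define L where "L = (\<lambda>\<omega>. b + T \<omega>)"
  define Z where "Z = (\<lambda>\<omega>. (U \<omega> - T \<omega>) - b)"
  have TS: "T \<in> S" unfolding T_def using finite_I Y_in by (rule sum)
  have UT: "(\<lambda>\<omega>. U \<omega> - T \<omega>) \<in> S" using U TS by (rule diff)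
  have LS: "L \<in> S" unfolding L_def by (intro add const TS)
  have "L \<in> borel_measurable D"
    unfolding L_def T_def using Y_measurable by measurable
  moreover have "residual Z"
    unfolding residual_def
  proof (intro conjI ballI)
    show "Z \<in> S" unfolding Z_def by (intro diff const U TS)
    show "expectation Z = 0"
      unfolding Z_def using integrable[OF UT] by (simp add: b_def prob_space)
    fix i assume i: "i \<in> I"
    then show "cov Z (Y i) = 0"
      unfolding Z_def cov_commute[of _ "Y i"] cov_diff[OF Y_in[OF i] UT const] cov_const[OF Y_in[OF i]]
      using a[OF i] by (simp add: T_def cov_commute)
  qed
  moreover have "cov R L = 0" if "residual R" for R
  proof -
    have R: "R \<in> S" "\<And>i. i \<in> I \<Longrightarrow> cov R (Y i) = 0" using that by (auto simp: residual_def)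
    then have "cov R T = 0" unfolding T_def using finite_I Y_in by (simp add: cov_sum)
    then show ?thesis using cov_add[OF R(1) const TS, of b] cov_const[OF R(1)] by (simp add: L_def)
  qed
  moreover have "U = (\<lambda>\<omega>. L \<omega> + Z \<omega>)" by (simp add: L_def Z_def)
  ultimately show ?thesis using LS by blast
qed

lemma cond_gaussian:
  assumes "U \<in> S"
  shows "cond_gaussian M D U"
proof -
  obtain L Z where L: "L \<in> borel_measurable D" and Z: "residual Z" and U: "U = (\<lambda>\<omega>. L \<omega> + Z \<omega>)"
    using exists_regression[OF assms] by blast
  note ZS = residual_in[OF Z]
  note [measurable] = meas[OF ZS]
  have "gaussian_measure (distr (distr M borel Z) borel (\<lambda>z. c + z))" for c
    using gaussian_measure_affine[OF meas[OF ZS] gaussian[OF ZS], of c 1]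
    by (simp add: distr_distr comp_def)
  then show ?thesis
    unfolding cond_gaussian_def U
    using cond_distribution_add_indep[OF subalgebra_D L meas[OF ZS] residual_indep[OF Z]] by blast
qed

lemma cond_exp_regression:
  assumes L: "L \<in> S" "L \<in> borel_measurable D" and Z: "residual Z"
    and U: "U \<in> borel_measurable M" and eq: "AE \<omega> in M. U \<omega> = L \<omega> + Z \<omega>"
  shows "AE \<omega> in M. real_cond_exp M D U \<omega> = L \<omega>"
proof -
  interpret D: finite_measure_subalgebra M D by (rule finite_measure_subalgebraI[OF subalgebra_D])
  note [measurable] = U meas[OF L(1)] meas[OF residual_in[OF Z]]
  have "AE \<omega> in M. real_cond_exp M D U \<omega> = real_cond_exp M D (\<lambda>\<omega>. L \<omega> + Z \<omega>) \<omega>"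
    using eq by (rule D.real_cond_exp_cong) auto
  moreover have "AE \<omega> in M. real_cond_exp M D (\<lambda>\<omega>. L \<omega> + Z \<omega>) \<omega> = real_cond_exp M D L \<omega> + real_cond_exp M D Z \<omega>"
    using integrable L(1) residual_in[OF Z] by (intro D.real_cond_exp_add) auto
  moreover have "AE \<omega> in M. real_cond_exp M D L \<omega> = L \<omega>"
    using integrable L by (intro D.real_cond_exp_F_meas) auto
  ultimately show ?thesis using cond_exp_residual[OF Z] by eventually_elim simp
qed

text \<open>The conditional means are \<open>L\<close> and \<open>L'\<close>, so centring leaves
  \<open>Z\<close> and \<open>Z'\<close>. The product of two residuals has constant conditional
  expectation, which makes the conditional covariance deterministic almost everywhere.\<close>

lemma cond_cov_regression:
  assumes L: "L \<in> S" "L \<in> borel_measurable D" and Z: "residual Z"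
    and U: "U \<in> borel_measurable M" and eq: "AE \<omega> in M. U \<omega> = L \<omega> + Z \<omega>"
    and L': "L' \<in> S" "L' \<in> borel_measurable D" and Z': "residual Z'"
    and U': "U' \<in> borel_measurable M" and eq': "AE \<omega> in M. U' \<omega> = L' \<omega> + Z' \<omega>"
  shows "AE \<omega> in M. cond_cov M D U U' \<omega> = cov Z Z'"
proof -
  interpret D: finite_measure_subalgebra M D by (rule finite_measure_subalgebraI[OF subalgebra_D])
  note [measurable] = U U' meas[OF residual_in[OF Z]] meas[OF residual_in[OF Z']]
  have "AE \<omega> in M. cond_cov M D U U' \<omega> = real_cond_exp M D (\<lambda>\<omega>. Z \<omega> * Z' \<omega>) \<omega>"
    unfolding cond_cov_def
  proof (rule D.real_cond_exp_cong)
    show "AE \<omega> in M. (U \<omega> - real_cond_exp M D U \<omega>) * (U' \<omega> - real_cond_exp M D U' \<omega>) = Z \<omega> * Z' \<omega>"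
      using cond_exp_regression[OF L Z U eq] cond_exp_regression[OF L' Z' U' eq'] eq eq'
      by eventually_elim simp
  qed auto
  then show ?thesis
    using cond_exp_residual_mult[OF Z Z'] by eventually_elim simp
qed

lemma cond_var_eq_cond_cov: "cond_var M D U = cond_cov M D U U"
  by (simp add: cond_var_def cond_cov_def power2_eq_square)

text \<open>Splitting \<open>V\<close> and \<open>V'\<close> into regression and error shows that
  the error of \<open>U\<close> is \<open>R\<close> plus the same combination of the errors of
  \<open>V\<close> and \<open>V'\<close>. As \<open>R\<close> is uncorrelated with these errors, its
  variance simply adds. The two mixed terms are listed separately to match the entries of a
  quadratic form; \<open>V\<close> and \<open>V'\<close> may coincide.\<close>

theorem cond_linear_combination:
  assumes U: "U \<in> borel_measurable M" and V: "V \<in> S" "V' \<in> S" and R: "residual R"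
    and eq: "AE \<omega> in M. U \<omega> = c + a * V \<omega> + b * V' \<omega> + R \<omega>"
    and cov: "cov R V = 0" "cov R V' = 0"
  shows "AE \<omega> in M. real_cond_exp M D U \<omega>
      = c + a * real_cond_exp M D V \<omega> + b * real_cond_exp M D V' \<omega>"
    and "AE \<omega> in M. cond_var M D U \<omega> = a\<^sup>2 * cond_cov M D V V \<omega> + a * b * cond_cov M D V V' \<omega>
      + b * a * cond_cov M D V' V \<omega> + b\<^sup>2 * cond_cov M D V' V' \<omega> + variance R"
proof -
  obtain L Z where L: "L \<in> S" "L \<in> borel_measurable D" and Z: "residual Z"
    and VL: "V = (\<lambda>\<omega>. L \<omega> + Z \<omega>)" and RL: "cov R L = 0"
    using exists_regression[OF V(1)] R by blast
  obtain L' Z' where L': "L' \<in> S" "L' \<in> borel_measurable D" and Z': "residual Z'"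
    and VL': "V' = (\<lambda>\<omega>. L' \<omega> + Z' \<omega>)" and RL': "cov R L' = 0"
    using exists_regression[OF V(2)] R by blast
  note S = residual_in[OF R] residual_in[OF Z] residual_in[OF Z']
  \<comment> \<open>\<open>R\<close> is uncorrelated with \<open>V\<close> by hypothesis and with
    \<open>L\<close> as a residual, hence with the difference \<open>Z\<close>; likewise for
    \<open>Z'\<close>.\<close>
  have RZ: "cov R Z = 0" "cov R Z' = 0"
    using cov RL RL' S L(1) L'(1) by (simp_all add: VL VL' cov_add)
  define L0 where "L0 = (\<lambda>\<omega>. c + a * L \<omega> + b * L' \<omega>)"
  define Z1 where "Z1 = (\<lambda>\<omega>. a * Z \<omega> + b * Z' \<omega>)"
  define Z0 where "Z0 = (\<lambda>\<omega>. R \<omega> + Z1 \<omega>)"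
  note [measurable] = L(2) L'(2)
  have L0: "L0 \<in> S" "L0 \<in> borel_measurable D"
    unfolding L0_def using L(1) L'(1) by (auto intro!: add scale const)
  have Z1: "residual Z1"
    unfolding Z1_def by (intro residual_add residual_scale R Z Z')
  have Z0: "residual Z0"
    unfolding Z0_def by (intro residual_add R Z1)
  have eq0: "AE \<omega> in M. U \<omega> = L0 \<omega> + Z0 \<omega>"
    using eq by eventually_elim (simp add: VL VL' L0_def Z0_def Z1_def algebra_simps)
  have VAE: "AE \<omega> in M. V \<omega> = L \<omega> + Z \<omega>" "AE \<omega> in M. V' \<omega> = L' \<omega> + Z' \<omega>"
    by (simp_all add: VL VL')
  show "AE \<omega> in M. real_cond_exp M D U \<omega>
      = c + a * real_cond_exp M D V \<omega> + b * real_cond_exp M D V' \<omega>"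
    using cond_exp_regression[OF L0 Z0 U eq0] cond_exp_regression[OF L Z meas[OF V(1)] VAE(1)]
      cond_exp_regression[OF L' Z' meas[OF V(2)] VAE(2)]
    by eventually_elim (simp add: L0_def)
  have "cov R Z1 = 0"
    unfolding Z1_def using RZ S by (simp add: cov_add scale cov_scale)
  then have "cov Z0 Z0 = cov R R + cov Z1 Z1"
    unfolding Z0_def using cov_add_self[OF S(1) residual_in[OF Z1]] by simp
  also have "cov Z1 Z1 = a\<^sup>2 * cov Z Z + 2 * (a * b * cov Z Z') + b\<^sup>2 * cov Z' Z'"
  proof -
    have "cov (\<lambda>\<omega>. a * X \<omega>) (\<lambda>\<omega>. b * X' \<omega>) = a * b * cov X X'" for a b X X'
    proof -
      have "cov (\<lambda>\<omega>. a * X \<omega>) W = a * cov X W" for W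
        by (subst cov_commute) (simp add: cov_scale cov_commute[of W X])
      then show ?thesis by (simp add: cov_scale)
    qed
    then show ?thesis
      unfolding Z1_def using cov_add_self[OF scale[OF S(2), of a] scale[OF S(3), of b]]
      by (simp add: power2_eq_square)
  qed
  also have "cov R R = variance R" using S by (simp add: cov_self)
  finally have covZ0: "cov Z0 Z0 = variance R + (a\<^sup>2 * cov Z Z + 2 * (a * b * cov Z Z') + b\<^sup>2 * cov Z' Z')" .
  show "AE \<omega> in M. cond_var M D U \<omega> = a\<^sup>2 * cond_cov M D V V \<omega> + a * b * cond_cov M D V V' \<omega>
      + b * a * cond_cov M D V' V \<omega> + b\<^sup>2 * cond_cov M D V' V' \<omega> + variance R"
    unfolding cond_var_eq_cond_cov
    using cond_cov_regression[OF L0 Z0 U eq0 L0 Z0 U eq0]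
      cond_cov_regression[OF L Z meas[OF V(1)] VAE(1) L Z meas[OF V(1)] VAE(1)]
      cond_cov_regression[OF L Z meas[OF V(1)] VAE(1) L' Z' meas[OF V(2)] VAE(2)]
      cond_cov_regression[OF L' Z' meas[OF V(2)] VAE(2) L Z meas[OF V(1)] VAE(1)]
      cond_cov_regression[OF L' Z' meas[OF V(2)] VAE(2) L' Z' meas[OF V(2)] VAE(2)]
    by eventually_elim (simp add: covZ0 cov_commute[of Z' Z])
qed

end

section \<open>Constructing Gaussian spaces\<close>

lemma gaussian_measure_normal_measure: "0 \<le> s \<Longrightarrow> gaussian_measure (normal_measure m s)"
  unfolding gaussian_measure_def by blast

definition affine_span :: "'i set \<Rightarrow> ('i \<Rightarrow> 'a \<Rightarrow> real) \<Rightarrow> ('a \<Rightarrow> real) set" where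
  "affine_span I X = {(\<lambda>\<omega>. c + (\<Sum>i\<in>I. a i * X i \<omega>)) |c a. True}"

text \<open>Equality is required only almost everywhere, since a Brownian motion is tied to its
  initial value and Wiener process only up to a null set. Measurability is imposed separately
  because \<open>M\<close> need not be complete.\<close>

definition ae_sums :: "'a measure \<Rightarrow> ('a \<Rightarrow> real) set \<Rightarrow> ('a \<Rightarrow> real) set \<Rightarrow> ('a \<Rightarrow> real) set" where
  "ae_sums M A B = {Z \<in> borel_measurable M. \<exists>X\<in>A. \<exists>Y\<in>B. AE \<omega> in M. Z \<omega> = X \<omega> + Y \<omega>}"

lemma affine_spanI:
  assumes "\<And>\<omega>. U \<omega> = c + (\<Sum>i\<in>I. a i * X i \<omega>)"
  shows "U \<in> affine_span I X"
proof -
  have "U = (\<lambda>\<omega>. c + (\<Sum>i\<in>I. a i * X i \<omega>))" using assms by (rule ext)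
  then show ?thesis unfolding affine_span_def by blast
qed

lemma ae_sumsI:
  assumes "Z \<in> borel_measurable M" "X \<in> A" "Y \<in> B" "AE \<omega> in M. Z \<omega> = X \<omega> + Y \<omega>"
  shows "Z \<in> ae_sums M A B"
  using assms unfolding ae_sums_def by blast

lemma affine_span_mem:
  assumes "finite I" "i \<in> I"
  shows "X i \<in> affine_span I X"
  using assms
  by (intro affine_spanI[where c = 0 and a = "\<lambda>j. of_bool (j = i)"])
    (simp add: of_bool_def if_distrib[of "\<lambda>x. x * _"] cong: if_cong)

lemma affine_span_const: "(\<lambda>\<omega>. c) \<in> affine_span I X"
  by (rule affine_spanI[where c = c and a = "\<lambda>_. 0"]) simp

lemma affine_span_measurable:
  assumes "\<And>i. i \<in> I \<Longrightarrow> X i \<in> borel_measurable F" "U \<in> affine_span I X"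
  shows "U \<in> borel_measurable F"
  using assms unfolding affine_span_def by auto

context prob_space
begin

lemma gaussian_space_affine_span:
  assumes "finite I" "jointly_gaussian M I X"
  shows "gaussian_space M (affine_span I X)"
proof
  have meas: "(\<lambda>\<omega>. \<Sum>i\<in>I. a i * X i \<omega>) \<in> borel_measurable M" for a
    using assms by (intro borel_measurable_sum) (auto simp: jointly_gaussian_def)
  fix U V :: "'a \<Rightarrow> real" and c :: real
  assume "U \<in> affine_span I X"
  then obtain c1 a1 where U: "U = (\<lambda>\<omega>. c1 + (\<Sum>i\<in>I. a1 i * X i \<omega>))" by (auto simp: affine_span_def)
  show "U \<in> borel_measurable M" unfolding U by (intro borel_measurable_add meas) simp
  show "gaussian_measure (distr M borel U)"
    unfolding U using gaussian_measure_affine[OF meas, of a1 c1 1] assms by (simp add: jointly_gaussian_def)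
  show "(\<lambda>\<omega>. c * U \<omega>) \<in> affine_span I X"
    by (rule affine_spanI[where c = "c * c1" and a = "\<lambda>i. c * a1 i"])
      (simp add: U sum_distrib_left algebra_simps)
  assume "V \<in> affine_span I X"
  then obtain c2 a2 where V: "V = (\<lambda>\<omega>. c2 + (\<Sum>i\<in>I. a2 i * X i \<omega>))" by (auto simp: affine_span_def)
  show "(\<lambda>\<omega>. U \<omega> + V \<omega>) \<in> affine_span I X"
    by (rule affine_spanI[where c = "c1 + c2" and a = "\<lambda>i. a1 i + a2 i"])
      (simp add: U V sum.distrib algebra_simps)
qed (rule affine_span_const)

lemma indep_affine_span:
  assumes "indep_set (sets F) (sets G)" "space F = space M" "space G = space M"
    and "\<And>i. i \<in> I \<Longrightarrow> X i \<in> borel_measurable F" "\<And>j. j \<in> J \<Longrightarrow> Y j \<in> borel_measurable G"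
    and "U \<in> affine_span I X" "V \<in> affine_span J Y"
  shows "indep_var borel U borel V"
  using affine_span_measurable[of I X F U] affine_span_measurable[of J Y G V] assms
  by (intro indep_var_of_indep_set[of F G]) auto

lemma distr_cong_AE_borel:
  fixes X Y :: "'a \<Rightarrow> real"
  assumes "X \<in> borel_measurable M" "Y \<in> borel_measurable M" "AE \<omega> in M. X \<omega> = Y \<omega>"
  shows "distr M borel X = distr M borel Y"
  using assms by (intro distr_cong_AE) auto

text \<open>Linear combinations regroup into one summand from each space, and a sum of two
  independent Gaussian variables is Gaussian. The construction serves twice: to join the initial
  value with the Wiener process, and to join the errors with \<open>f\<close>.\<close>

lemma gaussian_space_ae_sums:
  assumes A: "gaussian_space M A" and B: "gaussian_space M B"
    and indep: "\<And>X Y. X \<in> A \<Longrightarrow> Y \<in> B \<Longrightarrow> indep_var borel X borel Y"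
  shows "gaussian_space M (ae_sums M A B)"
proof -
  interpret A: gaussian_space M A by fact
  interpret B: gaussian_space M B by fact
  show ?thesis
  proof
    fix U V :: "'a \<Rightarrow> real" and c :: real
    assume "U \<in> ae_sums M A B"
    then obtain X Y where U: "U \<in> borel_measurable M" and XY: "X \<in> A" "Y \<in> B"
      and eq: "AE \<omega> in M. U \<omega> = X \<omega> + Y \<omega>" by (auto simp: ae_sums_def)
    show "U \<in> borel_measurable M" by fact
    have "distr M borel U = distr M borel (\<lambda>\<omega>. X \<omega> + Y \<omega>)"
      using A.meas B.meas XY U eq by (intro distr_cong_AE_borel) auto
    then show "gaussian_measure (distr M borel U)"
      using gaussian_measure_add[OF indep A.gaussian B.gaussian] XY by simp
    have "AE \<omega> in M. c * U \<omega> = c * X \<omega> + c * Y \<omega>"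
      using eq by eventually_elim (simp add: algebra_simps)
    then show "(\<lambda>\<omega>. c * U \<omega>) \<in> ae_sums M A B"
      using U by (intro ae_sumsI[OF _ A.scale[OF XY(1), of c] B.scale[OF XY(2), of c]]) auto
    assume "V \<in> ae_sums M A B"
    then obtain X' Y' where V: "V \<in> borel_measurable M" and XY': "X' \<in> A" "Y' \<in> B"
      and eq': "AE \<omega> in M. V \<omega> = X' \<omega> + Y' \<omega>" by (auto simp: ae_sums_def)
    have "AE \<omega> in M. U \<omega> + V \<omega> = (X \<omega> + X' \<omega>) + (Y \<omega> + Y' \<omega>)"
      using eq eq' by eventually_elim simp
    then show "(\<lambda>\<omega>. U \<omega> + V \<omega>) \<in> ae_sums M A B"
      using U V by (intro ae_sumsI[OF _ A.add[OF XY(1) XY'(1)] B.add[OF XY(2) XY'(2)]]) auto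
  next
    fix c :: real
    show "(\<lambda>\<omega>. c) \<in> ae_sums M A B"
      by (rule ae_sumsI[OF _ A.const[of c] B.const[of 0]]) auto
  qed
qed

lemma ae_sumsI1:
  assumes "gaussian_space M A" "gaussian_space M B" "X \<in> A"
  shows "X \<in> ae_sums M A B"
proof -
  interpret A: gaussian_space M A by fact
  interpret B: gaussian_space M B by fact
  show ?thesis by (rule ae_sumsI[OF A.meas[OF assms(3)] assms(3) B.const[of 0]]) simp
qed

lemma ae_sumsI2:
  assumes "gaussian_space M A" "gaussian_space M B" "Y \<in> B"
  shows "Y \<in> ae_sums M A B"
proof -
  interpret A: gaussian_space M A by fact
  interpret B: gaussian_space M B by fact
  show ?thesis by (rule ae_sumsI[OF B.meas[OF assms(3)] A.const[of 0] assms(3)]) simp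
qed

lemma ae_sums_cong_AE:
  assumes "X \<in> ae_sums M A B" "Z \<in> borel_measurable M" "AE \<omega> in M. Z \<omega> = X \<omega>"
  shows "Z \<in> ae_sums M A B"
proof -
  obtain U V where UV: "U \<in> A" "V \<in> B" "AE \<omega> in M. X \<omega> = U \<omega> + V \<omega>"
    using assms(1) by (auto simp: ae_sums_def)
  have "AE \<omega> in M. Z \<omega> = U \<omega> + V \<omega>"
    using assms(3) UV(3) by eventually_elim simp
  then show ?thesis using UV assms(2) unfolding ae_sums_def by blast
qed

lemma cov_indep:
  assumes "indep_var borel X borel Y" "integrable M X" "integrable M Y"
  shows "cov X Y = 0"
  using indep_var_lebesgue_integral[OF assms] by (simp add: cov_def)

lemma cov_cong_AE:
  fixes X X' Y Y' :: "'a \<Rightarrow> real"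
  assumes "X \<in> borel_measurable M" "X' \<in> borel_measurable M" "AE \<omega> in M. X \<omega> = X' \<omega>"
    and "Y \<in> borel_measurable M" "Y' \<in> borel_measurable M" "AE \<omega> in M. Y \<omega> = Y' \<omega>"
  shows "cov X Y = cov X' Y'"
proof -
  have "expectation X = expectation X'" "expectation Y = expectation Y'"
    using assms by (auto intro: integral_cong_AE)
  moreover have "expectation (\<lambda>\<omega>. X \<omega> * Y \<omega>) = expectation (\<lambda>\<omega>. X' \<omega> * Y' \<omega>)"
  proof (rule integral_cong_AE)
    show "AE \<omega> in M. X \<omega> * Y \<omega> = X' \<omega> * Y' \<omega>"
      using assms(3,6) by eventually_elim simp
  qed (use assms in auto)
  ultimately show ?thesis by (simp add: cov_def)
qed

lemma distr_normal_moments: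
  fixes X :: "'a \<Rightarrow> real"
  assumes [measurable]: "X \<in> borel_measurable M" and "distr M borel X = normal_measure m s" "0 \<le> s"
  shows "expectation X = m" "variance X = s\<^sup>2"
proof -
  show m: "expectation X = m"
    using normal_measure_moments(3)[OF assms(3), of m] by (simp add: assms(2)[symmetric] integral_distr)
  show "variance X = s\<^sup>2"
    using normal_measure_moments(4)[OF assms(3), of m] by (simp add: assms(2)[symmetric] integral_distr m)
qed

end

section \<open>The Wiener process\<close>

text \<open>The coefficients are the tail sums of \<open>b\<close>. They are chosen before
  \<open>w\<close>, so a single \<open>c\<close> works when \<open>w\<close> is the path of the
  process at every sample point.\<close>

lemma summation_by_parts:
  fixes b :: "nat \<Rightarrow> real"
  shows "\<exists>c. \<forall>w. (\<Sum>j\<le>m. b j * w j) = (\<Sum>i<m. c i * (w (Suc i) - w i)) + (\<Sum>j\<le>m. b j) * w 0"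
proof (induction m arbitrary: b)
  case 0
  then show ?case by simp
next
  case (Suc m)
  \<comment> \<open>Writing \<open>w (Suc m)\<close> as \<open>w m\<close> plus the last increment
    moves the weight \<open>b (Suc m)\<close> to position \<open>m\<close>.\<close>
  define b' where "b' = b(m := b m + b (Suc m))"
  obtain c where c: "\<And>w. (\<Sum>j\<le>m. b' j * w j) = (\<Sum>i<m. c i * (w (Suc i) - w i)) + (\<Sum>j\<le>m. b' j) * w 0"
    using Suc[of b'] by blast
  have split: "(\<Sum>j\<le>m. g j) = (\<Sum>j<m. g j) + g m" for g :: "nat \<Rightarrow> real"
    by (simp add: lessThan_Suc_atMost[symmetric])
  have *: "(\<Sum>j\<le>m. b' j * w j) = (\<Sum>j\<le>m. b j * w j) + b (Suc m) * w m" for w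
    unfolding split by (auto simp: b'_def algebra_simps intro!: sum.cong)
  \<comment> \<open>The preceding identity at the constant sequence 1.\<close>
  have **: "(\<Sum>j\<le>m. b' j) = (\<Sum>j\<le>Suc m. b j)"
    using *[of "\<lambda>_. 1"] by simp
  have "(\<Sum>j\<le>Suc m. b j * w j)
      = (\<Sum>i<Suc m. (c(m := b (Suc m))) i * (w (Suc i) - w i)) + (\<Sum>j\<le>Suc m. b j) * w 0" for w
  proof -
    have "(\<Sum>i<m. (c(m := b (Suc m))) i * (w (Suc i) - w i)) = (\<Sum>i<m. c i * (w (Suc i) - w i))"
      by (intro sum.cong) auto
    then show ?thesis using c[of w] unfolding * ** by (simp add: algebra_simps)
  qed
  then show ?case by blast
qed

context prob_space
begin

text \<open>After sorting the times, summation by parts turns a linear combination of values into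
  one of independent Gaussian increments, up to a multiple of \<open>W 0\<close>, which vanishes
  almost everywhere.\<close>

lemma wiener_jointly_gaussian:
  assumes W: "wiener_process M W" and "finite T" "T \<subseteq> {0..}"
  shows "jointly_gaussian M T W"
  unfolding jointly_gaussian_def
proof (intro conjI ballI allI)
  have meas: "W t \<in> borel_measurable M" if "0 \<le> t" for t
    using W that by (simp add: wiener_process_def)
  then show "W t \<in> borel_measurable M" if "t \<in> T" for t
    using assms(3) that by auto
  fix a :: "real \<Rightarrow> real"
  define l where "l = sorted_list_of_set T"
  define m where "m = length l"
  \<comment> \<open>Time 0 is put in front of the sorted list, so indices shift by one. If
    \<open>0\<close> lies in \<open>T\<close> as well, the first increment has length zero and a
    degenerate law.\<close>
  define \<tau> where "\<tau> i = (if i = 0 then 0 else l ! (i - 1))" for i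
  have l: "set l = T" "sorted l" "distinct l"
    using assms(2) by (auto simp: l_def)
  have \<tau>_mono: "\<tau> i \<le> \<tau> (Suc i)" if "i < m" for i
  proof (cases i)
    case 0
    then show ?thesis using that l(1) assms(3) by (auto simp: \<tau>_def m_def)
  next
    case (Suc j)
    then show ?thesis using that sorted_nth_mono[OF l(2), of j "Suc j"] by (simp add: \<tau>_def m_def)
  qed
  have \<tau>0: "0 \<le> \<tau> i" if "i \<le> m" for i
    using that l(1) assms(3) by (cases i) (auto simp: \<tau>_def m_def)
  define \<Delta> where "\<Delta> i = (\<lambda>\<omega>. W (\<tau> (Suc i)) \<omega> - W (\<tau> i) \<omega>)" for i
  have "indep_vars (\<lambda>_. borel) \<Delta> {..<m}"
  proof -
    have "\<forall>t m. 0 \<le> t 0 \<and> (\<forall>i<m. t i \<le> t (Suc i)) \<longrightarrow>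
        indep_vars (\<lambda>_. borel) (\<lambda>i \<omega>. W (t (Suc i)) \<omega> - W (t i) \<omega>) {..<m}"
      using W unfolding wiener_process_def by (elim conjE)
    moreover have "0 \<le> \<tau> 0" by (simp add: \<tau>_def)
    ultimately show ?thesis unfolding \<Delta>_def using \<tau>_mono by blast
  qed
  \<comment> \<open>The prepended time 0 gets weight zero; if \<open>0\<close> belongs to
    \<open>T\<close>, its own weight sits at index 1.\<close>
  define b where "b j = (if j = 0 then 0 else a (\<tau> j))" for j
  obtain c where c: "\<And>w. (\<Sum>j\<le>m. b j * w j) = (\<Sum>i<m. c i * (w (Suc i) - w i)) + (\<Sum>j\<le>m. b j) * w 0"
    using summation_by_parts[of b m] by blast
  have sum_eq: "(\<Sum>t\<in>T. a t * W t \<omega>) = (\<Sum>j\<le>m. b j * W (\<tau> j) \<omega>)" for \<omega>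
  proof -
    have "(\<Sum>t\<in>T. a t * W t \<omega>) = (\<Sum>i<m. a (l ! i) * W (l ! i) \<omega>)"
      using l by (intro sum.reindex_bij_betw[symmetric] bij_betw_nth) (auto simp: m_def)
    then show ?thesis by (simp add: sum.atMost_shift b_def \<tau>_def)
  qed
  have "AE \<omega> in M. W 0 \<omega> = 0" using W by (simp add: wiener_process_def)
  then have eq: "AE \<omega> in M. (\<Sum>t\<in>T. a t * W t \<omega>) = (\<Sum>i<m. c i * \<Delta> i \<omega>)"
    by eventually_elim (use c in \<open>simp add: sum_eq \<Delta>_def \<tau>_def\<close>)
  have \<Delta>_meas: "\<Delta> i \<in> borel_measurable M" if "i < m" for i
    unfolding \<Delta>_def using that \<tau>0 by (intro borel_measurable_diff meas) auto
  have "gaussian_measure (distr M borel (\<lambda>\<omega>. \<Sum>i<m. c i * \<Delta> i \<omega>))"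
  proof (rule gaussian_measure_sum)
    show "indep_vars (\<lambda>_. borel) (\<lambda>i \<omega>. c i * \<Delta> i \<omega>) {..<m}"
      using \<open>indep_vars (\<lambda>_. borel) \<Delta> {..<m}\<close> by (rule indep_vars_compose2) auto
    fix i assume i: "i \<in> {..<m}"
    have "distr M borel (\<Delta> i) = normal_measure 0 (sqrt (\<tau> (Suc i) - \<tau> i))"
      unfolding \<Delta>_def using W \<tau>_mono[of i] \<tau>0[of i] i by (simp add: wiener_process_def)
    then have "gaussian_measure (distr M borel (\<Delta> i))"
      using \<tau>_mono[of i] i by (simp add: gaussian_measure_normal_measure)
    then show "gaussian_measure (distr M borel (\<lambda>\<omega>. c i * \<Delta> i \<omega>))"
      using gaussian_measure_affine[OF \<Delta>_meas, of i 0 "c i"] i by simp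
  qed simp
  moreover have "distr M borel (\<lambda>\<omega>. \<Sum>t\<in>T. a t * W t \<omega>) = distr M borel (\<lambda>\<omega>. \<Sum>i<m. c i * \<Delta> i \<omega>)"
    using eq \<Delta>_meas meas assms(3) by (intro distr_cong_AE_borel borel_measurable_sum borel_measurable_times) auto
  ultimately show "gaussian_measure (distr M borel (\<lambda>\<omega>. \<Sum>t\<in>T. a t * W t \<omega>))" by simp
qed

text \<open>For \<open>u \<le> v\<close> the covariance is recovered from three variances: the
  increment has variance \<open>v - u\<close>, which must equal \<open>v\<close> minus twice the
  covariance plus \<open>u\<close>.\<close>

lemma wiener_moments:
  assumes W: "wiener_process M W" and "0 \<le> s" "0 \<le> t"
  shows "expectation (W t) = 0" "cov (W s) (W t) = min s t"
proof -
  have meas: "W u \<in> borel_measurable M" if "0 \<le> u" for u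
    using W that by (simp add: wiener_process_def)
  have incr: "distr M borel (\<lambda>\<omega>. W v \<omega> - W u \<omega>) = normal_measure 0 (sqrt (v - u))" if "0 \<le> u" "u \<le> v" for u v
    using W that by (simp add: wiener_process_def)
  have W0: "AE \<omega> in M. W 0 \<omega> = 0" using W by (simp add: wiener_process_def)
  have law: "distr M borel (W u) = normal_measure 0 (sqrt u)" if "0 \<le> u" for u
  proof -
    have "distr M borel (W u) = distr M borel (\<lambda>\<omega>. W u \<omega> - W 0 \<omega>)"
      using W0 meas that by (intro distr_cong_AE_borel) auto
    then show ?thesis using incr[of 0 u] that by simp
  qed
  show "expectation (W t) = 0"
    using distr_normal_moments(1)[OF meas law] assms by simp
  have ordered: "cov (W u) (W v) = u" if "0 \<le> u" "u \<le> v" for u v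
  proof -
    have uv: "0 \<le> v" "finite {u, v}" "{u, v} \<subseteq> {0..}" using that by auto
    interpret G: gaussian_space M "affine_span {u, v} W"
      by (rule gaussian_space_affine_span[OF uv(2) wiener_jointly_gaussian[OF W uv(2,3)]])
    have mem: "W u \<in> affine_span {u, v} W" "W v \<in> affine_span {u, v} W"
      by (auto intro: affine_span_mem)
    have dmem: "(\<lambda>\<omega>. W v \<omega> - W u \<omega>) \<in> affine_span {u, v} W" by (rule G.diff[OF mem(2,1)])
    have "cov (W u) (W u) = u" "cov (W v) (W v) = v"
      using distr_normal_moments(2)[OF meas law, of u] distr_normal_moments(2)[OF meas law, of v] that uv(1)
      by (simp_all add: G.cov_self mem)
    moreover have "cov (\<lambda>\<omega>. W v \<omega> - W u \<omega>) (\<lambda>\<omega>. W v \<omega> - W u \<omega>) = v - u"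
      unfolding G.cov_self[OF dmem] using distr_normal_moments(2)[OF G.meas[OF dmem] incr] that by simp
    ultimately show ?thesis
      using G.cov_diff_self[OF mem(2,1)] G.cov_commute[of "W v" "W u"] by simp
  qed
  show "cov (W s) (W t) = min s t"
  proof (cases "s \<le> t")
    case True
    then show ?thesis using ordered[of s t] assms by simp
  next
    case False
    have "cov (W s) (W t) = cov (W t) (W s)" by (simp add: cov_def mult.commute)
    then show ?thesis using ordered[of t s] assms False by simp
  qed
qed

end

section \<open>Brownian motion with drift\<close>

lemma (in gaussian_space) jointly_gaussian_subset:
  assumes "finite I" "\<And>i. i \<in> I \<Longrightarrow> X i \<in> S"
  shows "jointly_gaussian M I X"
  using assms meas gaussian[OF sum[OF assms]] by (auto simp: jointly_gaussian_def)

context prob_space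
begin

text \<open>The initial value and the values of \<open>W\<close> on \<open>T\<close> generate two
  independent Gaussian spaces, and each \<open>f t\<close> is almost everywhere a member of their
  sum. Mean and covariance then follow by bilinearity, the mixed terms being zero. Finite
  \<open>T\<close> suffices because only the sampling points and \<open>x\<close> enter
  later.\<close>

lemma brownian_motion_drift_gaussian:
  assumes f: "brownian_motion_drift M \<mu> \<sigma> \<mu>0 \<sigma>0 f" and \<sigma>0: "0 \<le> \<sigma>0" and T: "finite T" "T \<subseteq> {0..}"
  shows "jointly_gaussian M T f"
    and "\<And>s. s \<in> T \<Longrightarrow> expectation (f s) = \<mu>0 + \<mu> * s"
    and "\<And>s t. s \<in> T \<Longrightarrow> t \<in> T \<Longrightarrow> cov (f s) (f t) = \<sigma>0\<^sup>2 + \<sigma>\<^sup>2 * min s t"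
proof -
  obtain W where W: "wiener_process M W"
    and indep: "indep_set (sets (vimage_algebra (space M) (f 0) borel)) (sets (generated_algebra M {0..} W))"
    and eq: "AE \<omega> in M. \<forall>x\<ge>0. f x \<omega> = f 0 \<omega> + \<mu> * x + \<sigma> * W x \<omega>"
    using f unfolding brownian_motion_drift_def by blast
  have f_meas: "f t \<in> borel_measurable M" if "0 \<le> t" for t
    using f that by (simp add: brownian_motion_drift_def)
  have f0_law: "distr M borel (f 0) = normal_measure \<mu>0 \<sigma>0"
    using f by (simp add: brownian_motion_drift_def)
  \<comment> \<open>A one-point index set presents the single variable \<open>f 0\<close> as a
    family.\<close>
  define A where "A = affine_span {()} (\<lambda>_. f 0)"
  define B where "B = affine_span T W"
  have "gaussian_measure (distr M borel (f 0))"
    unfolding f0_law by (rule gaussian_measure_normal_measure[OF \<sigma>0])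
  then have "jointly_gaussian M {()} (\<lambda>_. f 0)"
    using gaussian_measure_affine[OF f_meas[of 0], of 0] f_meas[of 0] by (simp add: jointly_gaussian_def)
  then have A: "gaussian_space M A" unfolding A_def by (intro gaussian_space_affine_span) auto
  have B: "gaussian_space M B"
    unfolding B_def using W T by (intro gaussian_space_affine_span wiener_jointly_gaussian)
  have AB: "indep_var borel X borel Y" if "X \<in> A" "Y \<in> B" for X Y
  proof (rule indep_affine_span[OF indep])
    show "f 0 \<in> borel_measurable (vimage_algebra (space M) (f 0) borel)"
      by (rule measurable_vimage_algebra1) simp
    show "W t \<in> borel_measurable (generated_algebra M {0..} W)" if "t \<in> T" for t
      using that T(2) by (intro measurable_generated_algebra) auto
  qed (use that in \<open>simp_all add: A_def B_def\<close>)
  interpret G: gaussian_space M "ae_sums M A B"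
    by (rule gaussian_space_ae_sums[OF A B AB])
  have f0A: "f 0 \<in> A" unfolding A_def by (rule affine_span_mem[where X = "\<lambda>_. f 0" and i = "()"]) auto
  have f0: "f 0 \<in> ae_sums M A B" by (rule ae_sumsI1[OF A B f0A])
  have WB: "W t \<in> B" if "t \<in> T" for t unfolding B_def using T(1) that by (rule affine_span_mem)
  have Wt: "W t \<in> ae_sums M A B" if "t \<in> T" for t by (rule ae_sumsI2[OF A B WB[OF that]])
  \<comment> \<open>An exact algebraic version of \<open>f t\<close>, to which the bilinear rules
    apply literally; the results are carried back to \<open>f t\<close> along almost everywhere
    equality.\<close>
  define g where "g t = (\<lambda>\<omega>. f 0 \<omega> + (\<mu> * t + \<sigma> * W t \<omega>))" for t
  have g: "g t \<in> ae_sums M A B" if "t \<in> T" for t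
    unfolding g_def by (rule G.add[OF f0 G.add[OF G.const G.scale[OF Wt[OF that]]]])
  have T0: "0 \<le> t" if "t \<in> T" for t using that T(2) by auto
  have fg: "AE \<omega> in M. f t \<omega> = g t \<omega>" if "t \<in> T" for t
    using eq
  proof eventually_elim
    case (elim \<omega>)
    then have "f t \<omega> = f 0 \<omega> + \<mu> * t + \<sigma> * W t \<omega>" using T0[OF that] by blast
    then show ?case by (simp add: g_def)
  qed
  show "jointly_gaussian M T f"
    by (rule G.jointly_gaussian_subset[OF T(1)], rule ae_sums_cong_AE[OF g f_meas[OF T0] fg])
  have E0: "expectation (f 0) = \<mu>0" and V0: "cov (f 0) (f 0) = \<sigma>0\<^sup>2"
    using distr_normal_moments[OF f_meas f0_law \<sigma>0] f0 by (simp_all add: G.cov_self)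
  show "expectation (f s) = \<mu>0 + \<mu> * s" if s: "s \<in> T" for s
  proof -
    have "expectation (f s) = expectation (g s)"
      by (rule integral_cong_AE[OF f_meas[OF T0[OF s]] G.meas[OF g[OF s]] fg[OF s]])
    also have "\<dots> = \<mu>0 + \<mu> * s"
      using G.integrable[OF f0] G.integrable[OF Wt[OF s]] wiener_moments(1)[OF W T0[OF s] T0[OF s]]
      by (simp add: g_def E0 prob_space)
    finally show ?thesis .
  qed
  have cov0: "cov (f 0) (W t) = 0" if "t \<in> T" for t
    using AB[OF f0A WB[OF that]] G.integrable[OF f0] G.integrable[OF Wt[OF that]] by (rule cov_indep)
  show "cov (f s) (f t) = \<sigma>0\<^sup>2 + \<sigma>\<^sup>2 * min s t" if s: "s \<in> T" and t: "t \<in> T" for s t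
  proof -
    have expand: "cov X (g u) = cov X (f 0) + \<sigma> * cov X (W u)" if X: "X \<in> ae_sums M A B" and u: "u \<in> T" for X u
      unfolding g_def
      using G.cov_add[OF X f0 G.add[OF G.const[of "\<mu> * u"] G.scale[OF Wt[OF u], of \<sigma>]]]
        G.cov_add[OF X G.const[of "\<mu> * u"] G.scale[OF Wt[OF u], of \<sigma>]] G.cov_const[OF X, of "\<mu> * u"]
      by (simp add: G.cov_scale)
    have "cov (f s) (f t) = cov (g s) (g t)"
      by (rule cov_cong_AE[OF f_meas[OF T0[OF s]] G.meas[OF g[OF s]] fg[OF s]
            f_meas[OF T0[OF t]] G.meas[OF g[OF t]] fg[OF t]])
    also have "\<dots> = cov (f 0) (g s) + \<sigma> * cov (W t) (g s)"
      using expand[OF g[OF s] t] G.cov_commute[of "g s" "f 0"] G.cov_commute[of "g s" "W t"] by simp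
    also have "\<dots> = \<sigma>0\<^sup>2 + \<sigma> * (\<sigma> * min t s)"
      using cov0[OF s] cov0[OF t] wiener_moments(2)[OF W T0[OF t] T0[OF s]]
      by (simp add: expand[OF f0 s] expand[OF Wt[OF t] s] V0 G.cov_commute[of "W t" "f 0"])
    finally show ?thesis by (simp add: power2_eq_square min.commute)
  qed
qed

end

section \<open>Prediction from noisy observations of Brownian motion\<close>

theorem corollary1:
  fixes M :: "'a measure"
    and f :: "real \<Rightarrow> 'a \<Rightarrow> real"
    and \<epsilon> y :: "nat \<Rightarrow> 'a \<Rightarrow> real"
    and xs :: "nat \<Rightarrow> real"
    and n :: nat
    and \<mu> \<sigma> \<mu>0 \<sigma>0 x :: real
    and D :: "'a measure"
  assumes "prob_space M"
    and "0 \<le> \<sigma>" and "0 \<le> \<sigma>0"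
    and "brownian_motion_drift M \<mu> \<sigma> \<mu>0 \<sigma>0 f"
    and "1 \<le> n"
    and "0 \<le> xs 1" and "mono_on {1..n} xs"
    and "jointly_gaussian M {1..n} \<epsilon>"
    and "\<And>i. i \<in> {1..n} \<Longrightarrow> integral\<^sup>L M (\<epsilon> i) = 0"
    and "prob_space.indep_set M (sets (generated_algebra M {1..n} \<epsilon>))
           (sets (generated_algebra M {0..} f))"
    and "\<And>i \<omega>. i \<in> {1..n} \<Longrightarrow> \<omega> \<in> space M \<Longrightarrow> y i \<omega> = f (xs i) \<omega> + \<epsilon> i \<omega>"
    and "D = generated_algebra M {1..n} y"
    and "0 \<le> x"
  shows "cond_gaussian M D (f x)
    \<and> (x \<le> xs 1 \<and> \<sigma>0\<^sup>2 + \<sigma>\<^sup>2 * xs 1 \<noteq> 0 \<longrightarrow>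
        (AE \<omega> in M. real_cond_exp M D (f x) \<omega> =
           \<mu>0 + \<mu> * x + (\<sigma>0\<^sup>2 + \<sigma>\<^sup>2 * x) / (\<sigma>0\<^sup>2 + \<sigma>\<^sup>2 * xs 1)
             * (real_cond_exp M D (f (xs 1)) \<omega> - \<mu>0 - \<mu> * xs 1)) \<and>
        (AE \<omega> in M. cond_var M D (f x) \<omega> =
           ((\<sigma>0\<^sup>2 + \<sigma>\<^sup>2 * x) / (\<sigma>0\<^sup>2 + \<sigma>\<^sup>2 * xs 1))\<^sup>2 * cond_var M D (f (xs 1)) \<omega>
           + (\<sigma>0\<^sup>2 + \<sigma>\<^sup>2 * x) / (\<sigma>0\<^sup>2 + \<sigma>\<^sup>2 * xs 1) * \<sigma>\<^sup>2 * (xs 1 - x)))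
    \<and> (\<forall>k. 1 \<le> k \<and> k < n \<and> xs k \<le> x \<and> x \<le> xs (k + 1) \<and> xs k < xs (k + 1) \<longrightarrow>
        (AE \<omega> in M. real_cond_exp M D (f x) \<omega> =
           (xs (k + 1) - x) / (xs (k + 1) - xs k) * real_cond_exp M D (f (xs k)) \<omega>
           + (x - xs k) / (xs (k + 1) - xs k) * real_cond_exp M D (f (xs (k + 1))) \<omega>) \<and>
        (AE \<omega> in M. cond_var M D (f x) \<omega> =
           1 / (xs (k + 1) - xs k)\<^sup>2 *
             ((vector [xs (k + 1) - x, x - xs k] :: real ^ 2) \<bullet>
              (cond_cov_matrix M D (\<lambda>\<omega>. vector [f (xs k) \<omega>, f (xs (k + 1)) \<omega>] :: real ^ 2) \<omega>
                 *v vector [xs (k + 1) - x, x - xs k]))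
           + \<sigma>\<^sup>2 * (xs (k + 1) - x) * (x - xs k) / (xs (k + 1) - xs k)))
    \<and> (xs n \<le> x \<longrightarrow>
        (AE \<omega> in M. real_cond_exp M D (f x) \<omega> =
           real_cond_exp M D (f (xs n)) \<omega> + \<mu> * (x - xs n)) \<and>
        (AE \<omega> in M. cond_var M D (f x) \<omega> =
           cond_var M D (f (xs n)) \<omega> + \<sigma>\<^sup>2 * (x - xs n)))"
proof -
  interpret prob_space M by fact
  note \<sigma>0 = assms(3) and bm = assms(4) and indep = assms(10)
  define T where "T = insert x (xs ` {1..n})"
  have xs_mono: "xs i \<le> xs j" if "1 \<le> i" "i \<le> j" "j \<le> n" for i j
    using assms(7) that by (auto simp: mono_on_def)
  have xs0: "0 \<le> xs i" if "i \<in> {1..n}" for i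
    using xs_mono[of 1 i] assms(6) that by simp
  have T: "finite T" "T \<subseteq> {0..}"
    using xs0 \<open>0 \<le> x\<close> by (auto simp: T_def)
  have xT: "x \<in> T" and xsT: "\<And>i. i \<in> {1..n} \<Longrightarrow> xs i \<in> T" by (auto simp: T_def)
  note f = brownian_motion_drift_gaussian[OF bm \<sigma>0 T]
  define C where "C s t = \<sigma>0\<^sup>2 + \<sigma>\<^sup>2 * min s t" for s t
  define A where "A = affine_span T f"
  define B where "B = affine_span {1..n} \<epsilon>"
  define S where "S = ae_sums M B A"
  have A: "gaussian_space M A"
    unfolding A_def by (rule gaussian_space_affine_span[OF T(1) f(1)])
  have B: "gaussian_space M B"
    unfolding B_def by (rule gaussian_space_affine_span[OF _ assms(8)]) simp
  have BA: "indep_var borel V borel U" if "V \<in> B" "U \<in> A" for U V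
  proof (rule indep_affine_span[OF indep])
    show "\<epsilon> i \<in> borel_measurable (generated_algebra M {1..n} \<epsilon>)" if "i \<in> {1..n}" for i
      using that by (rule measurable_generated_algebra)
    show "f t \<in> borel_measurable (generated_algebra M {0..} f)" if "t \<in> T" for t
      using that T(2) by (intro measurable_generated_algebra) auto
  qed (use that in \<open>simp_all add: A_def B_def\<close>)
  interpret G: gaussian_space M S
    unfolding S_def by (rule gaussian_space_ae_sums[OF B A BA])
  have fA: "f t \<in> A" if "t \<in> T" for t unfolding A_def using T(1) that by (rule affine_span_mem)
  have \<epsilon>B: "\<epsilon> i \<in> B" if "i \<in> {1..n}" for i unfolding B_def using that by (intro affine_span_mem) auto
  have fS: "f t \<in> S" if "t \<in> T" for t unfolding S_def by (rule ae_sumsI2[OF B A fA[OF that]])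
  have \<epsilon>S: "\<epsilon> i \<in> S" if "i \<in> {1..n}" for i unfolding S_def by (rule ae_sumsI1[OF B A \<epsilon>B[OF that]])
  have y_eq: "AE \<omega> in M. y i \<omega> = f (xs i) \<omega> + \<epsilon> i \<omega>" if "i \<in> {1..n}" for i
    using assms(11)[OF that] by simp
  have sumS: "(\<lambda>\<omega>. f (xs i) \<omega> + \<epsilon> i \<omega>) \<in> S" if "i \<in> {1..n}" for i
    by (rule G.add[OF fS[OF xsT[OF that]] \<epsilon>S[OF that]])
  have y_meas: "y i \<in> borel_measurable M" if "i \<in> {1..n}" for i
    using G.meas[OF sumS[OF that]] assms(11)[OF that] by (simp cong: measurable_cong)
  have yS: "y i \<in> S" if "i \<in> {1..n}" for i
    using sumS[OF that] y_meas[OF that] y_eq[OF that] unfolding S_def by (rule ae_sums_cong_AE)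
  interpret G: gaussian_data M S "{1..n}" y D
    by standard (use yS assms(12) in auto)
  have cov_\<epsilon>f: "cov (\<epsilon> i) (f t) = 0" if "t \<in> T" "i \<in> {1..n}" for t i
    by (rule cov_indep[OF BA[OF \<epsilon>B[OF that(2)] fA[OF that(1)]] G.integrable[OF \<epsilon>S[OF that(2)]] G.integrable[OF fS[OF that(1)]]])
  \<comment> \<open>The common form of the three cases. The error of predicting \<open>f x\<close>
    from the values at \<open>xs p\<close> and \<open>xs q\<close> is a residual as soon as the
    means agree and the covariance with every sampled value is interpolated with the same weights;
    the observation errors contribute nothing, being independent of \<open>f\<close>. One-sided
    cases take \<open>p = q\<close> and \<open>b = 0\<close>.\<close>
  have key: "AE \<omega> in M. real_cond_exp M D (f x) \<omega> =
        c + a * real_cond_exp M D (f (xs p)) \<omega> + b * real_cond_exp M D (f (xs q)) \<omega>"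
      "AE \<omega> in M. cond_var M D (f x) \<omega> =
        a\<^sup>2 * cond_cov M D (f (xs p)) (f (xs p)) \<omega> + a * b * cond_cov M D (f (xs p)) (f (xs q)) \<omega>
        + b * a * cond_cov M D (f (xs q)) (f (xs p)) \<omega> + b\<^sup>2 * cond_cov M D (f (xs q)) (f (xs q)) \<omega> + v"
    if p: "p \<in> {1..n}" and q: "q \<in> {1..n}"
      and mean: "\<mu>0 + \<mu> * x = c + a * (\<mu>0 + \<mu> * xs p) + b * (\<mu>0 + \<mu> * xs q)"
      and interp: "\<And>i. i \<in> {1..n} \<Longrightarrow> C x (xs i) = a * C (xs p) (xs i) + b * C (xs q) (xs i)"
      and v: "v = C x x - a * C (xs p) x - b * C (xs q) x"
    for a b c v p q
  proof -
    define P where "P = (\<lambda>\<omega>. c + (a * f (xs p) \<omega> + b * f (xs q) \<omega>))"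
    define R where "R = (\<lambda>\<omega>. f x \<omega> - P \<omega>)"
    note pT = xsT[OF p] and qT = xsT[OF q]
    have abS: "(\<lambda>\<omega>. a * f (xs p) \<omega> + b * f (xs q) \<omega>) \<in> S"
      by (rule G.add[OF G.scale[OF fS[OF pT]] G.scale[OF fS[OF qT]]])
    have PS: "P \<in> S" unfolding P_def by (rule G.add[OF G.const abS])
    have RS: "R \<in> S" unfolding R_def by (rule G.diff[OF fS[OF xT] PS])
    have covP: "cov X P = a * cov X (f (xs p)) + b * cov X (f (xs q))" if X: "X \<in> S" for X
      unfolding P_def G.cov_add[OF X G.const abS] G.cov_const[OF X]
        G.cov_add[OF X G.scale[OF fS[OF pT]] G.scale[OF fS[OF qT]]] G.cov_scale by simp
    have covR: "cov X R = cov X (f x) - (a * cov X (f (xs p)) + b * cov X (f (xs q)))" if X: "X \<in> S" for X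
      unfolding R_def G.cov_diff[OF X fS[OF xT] PS] covP[OF X] ..
    have covRf: "cov R (f t) = C x t - a * C (xs p) t - b * C (xs q) t" if t: "t \<in> T" for t
      unfolding G.cov_commute[of R] covR[OF fS[OF t]]
      by (simp add: f(3)[OF t xT] f(3)[OF t pT] f(3)[OF t qT] C_def min.commute)
    have "cov R (f (xs i)) = 0" if i: "i \<in> {1..n}" for i
      unfolding covRf[OF xsT[OF i]] interp[OF i] by simp
    note Rf = this
    have "cov R (y i) = 0" if i: "i \<in> {1..n}" for i
    proof -
      have "cov R (y i) = cov R (\<lambda>\<omega>. f (xs i) \<omega> + \<epsilon> i \<omega>)"
        using y_eq[OF i] by (intro cov_cong_AE G.meas RS yS sumS i) auto
      also have "\<dots> = cov R (f (xs i)) + cov (\<epsilon> i) R"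
        unfolding G.cov_add[OF RS fS[OF xsT[OF i]] \<epsilon>S[OF i]] G.cov_commute[of R "\<epsilon> i"] ..
      also have "\<dots> = 0"
        unfolding Rf[OF i] covR[OF \<epsilon>S[OF i]]
        by (simp add: cov_\<epsilon>f[OF xT i] cov_\<epsilon>f[OF pT i] cov_\<epsilon>f[OF qT i])
      finally show ?thesis .
    qed
    moreover have "expectation R = 0"
      unfolding R_def P_def
      using G.integrable[OF fS[OF xT]] G.integrable[OF fS[OF pT]] G.integrable[OF fS[OF qT]]
      by (simp add: f(2)[OF xT] f(2)[OF pT] f(2)[OF qT] prob_space mean)
    ultimately have R: "G.residual R" using RS unfolding G.residual_def by blast
    have eq: "AE \<omega> in M. f x \<omega> = c + a * f (xs p) \<omega> + b * f (xs q) \<omega> + R \<omega>"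
      by (simp add: R_def P_def)
    \<comment> \<open>As \<open>R\<close> is uncorrelated with \<open>f (xs p)\<close>,
      \<open>f (xs q)\<close> and constants, its variance equals \<open>cov R (f x)\<close>.\<close>
    have "variance R = v"
      unfolding G.cov_self[OF RS, symmetric] covR[OF RS] covRf[OF xT] Rf[OF p] Rf[OF q] v by simp
    then show "AE \<omega> in M. real_cond_exp M D (f x) \<omega> =
        c + a * real_cond_exp M D (f (xs p)) \<omega> + b * real_cond_exp M D (f (xs q)) \<omega>"
      "AE \<omega> in M. cond_var M D (f x) \<omega> =
        a\<^sup>2 * cond_cov M D (f (xs p)) (f (xs p)) \<omega> + a * b * cond_cov M D (f (xs p)) (f (xs q)) \<omega>
        + b * a * cond_cov M D (f (xs q)) (f (xs p)) \<omega> + b\<^sup>2 * cond_cov M D (f (xs q)) (f (xs q)) \<omega> + v"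
      using G.cond_linear_combination[OF G.meas[OF fS[OF xT]] fS[OF pT] fS[OF qT] R eq Rf[OF p] Rf[OF q]]
      by simp_all
  qed
  show ?thesis
  proof (intro conjI allI impI; (elim conjE)?)
    show "cond_gaussian M D (f x)" by (rule G.cond_gaussian[OF fS[OF xT]])
  next
    assume x: "x \<le> xs 1" and nz: "\<sigma>0\<^sup>2 + \<sigma>\<^sup>2 * xs 1 \<noteq> 0"
    \<comment> \<open>The regression coefficient of \<open>f x\<close> on \<open>f (xs 1)\<close>:
      covariance over variance, with \<open>min x (xs 1) = x\<close>.\<close>
    define r where "r = (\<sigma>0\<^sup>2 + \<sigma>\<^sup>2 * x) / (\<sigma>0\<^sup>2 + \<sigma>\<^sup>2 * xs 1)"
    have r: "r * (\<sigma>0\<^sup>2 + \<sigma>\<^sup>2 * xs 1) = \<sigma>0\<^sup>2 + \<sigma>\<^sup>2 * x" using nz by (simp add: r_def)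
    have 1: "1 \<in> {1..n}" using assms(5) by simp
    \<comment> \<open>Every sampling point lies to the right of both \<open>x\<close> and
      \<open>xs 1\<close>, so the two covariances do not depend on \<open>i\<close> and one ratio
      serves all observations.\<close>
    have interp: "C x (xs i) = r * C (xs 1) (xs i) + 0 * C (xs 1) (xs i)" if "i \<in> {1..n}" for i
      using xs_mono[of 1 i] that x r by (simp add: C_def min_absorb1)
    have "r * \<sigma>\<^sup>2 * (xs 1 - x) = r * (\<sigma>0\<^sup>2 + \<sigma>\<^sup>2 * xs 1) - r * (\<sigma>0\<^sup>2 + \<sigma>\<^sup>2 * x)"
      by (simp add: algebra_simps)
    then have v: "r * \<sigma>\<^sup>2 * (xs 1 - x) = C x x - r * C (xs 1) x - 0 * C (xs 1) x"
      unfolding r using x by (simp add: C_def min_absorb2)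
    \<comment> \<open>The intercept is chosen so that the mean condition becomes an identity; it
      remains as a premise for the simplifier.\<close>
    note K = key[of 1 1 "\<mu>0 + \<mu> * x - r * (\<mu>0 + \<mu> * xs 1)" r 0, OF 1 1 _ interp v]
    show "AE \<omega> in M. real_cond_exp M D (f x) \<omega> =
           \<mu>0 + \<mu> * x + (\<sigma>0\<^sup>2 + \<sigma>\<^sup>2 * x) / (\<sigma>0\<^sup>2 + \<sigma>\<^sup>2 * xs 1)
             * (real_cond_exp M D (f (xs 1)) \<omega> - \<mu>0 - \<mu> * xs 1)"
      using K(1) unfolding r_def[symmetric] by (simp add: algebra_simps)
    show "AE \<omega> in M. cond_var M D (f x) \<omega> =
           ((\<sigma>0\<^sup>2 + \<sigma>\<^sup>2 * x) / (\<sigma>0\<^sup>2 + \<sigma>\<^sup>2 * xs 1))\<^sup>2 * cond_var M D (f (xs 1)) \<omega>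
           + (\<sigma>0\<^sup>2 + \<sigma>\<^sup>2 * x) / (\<sigma>0\<^sup>2 + \<sigma>\<^sup>2 * xs 1) * \<sigma>\<^sup>2 * (xs 1 - x)"
      using K(2) unfolding r_def[symmetric] G.cond_var_eq_cond_cov[of "f (xs 1)"] by simp
  next
    fix k assume k: "1 \<le> k" "k < n" and x: "xs k \<le> x" "x \<le> xs (k + 1)" and lt: "xs k < xs (k + 1)"
    define d where "d = xs (k + 1) - xs k"
    define p where "p = xs (k + 1) - x"
    define q where "q = x - xs k"
    have d: "d \<noteq> 0" "p = d - q" using lt by (auto simp: d_def p_def q_def)
    have xk: "x = xs k + q" "xs (k + 1) = xs k + d" by (auto simp: q_def d_def)
    have kn: "k \<in> {1..n}" "k + 1 \<in> {1..n}" using k by auto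
    \<comment> \<open>As a function of its first argument, \<open>C\<close> with second argument
      \<open>xs i\<close> is affine on the interval from \<open>xs k\<close> to
      \<open>xs (k + 1)\<close>, since no sampling point lies strictly inside: it is constant for
      \<open>i \<le> k\<close> and has slope \<open>\<sigma>\<^sup>2\<close> otherwise. Linear
      interpolation is therefore exact for every \<open>i\<close>.\<close>
    have interp: "C x (xs i) = p / d * C (xs k) (xs i) + q / d * C (xs (k + 1)) (xs i)" if i: "i \<in> {1..n}" for i
    proof (cases "i \<le> k")
      case True
      then have "xs i \<le> xs k" using xs_mono[of i k] i k by auto
      then have "C x (xs i) = C (xs i) (xs i)" "C (xs k) (xs i) = C (xs i) (xs i)" "C (xs (k + 1)) (xs i) = C (xs i) (xs i)"
        using x lt by (auto simp: C_def min_absorb2)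
      then show ?thesis using d(1) by (simp add: d(2) field_simps)
    next
      case False
      then have "xs (k + 1) \<le> xs i" using xs_mono[of "k + 1" i] i k by auto
      then have "C x (xs i) = \<sigma>0\<^sup>2 + \<sigma>\<^sup>2 * (xs k + q)" "C (xs k) (xs i) = \<sigma>0\<^sup>2 + \<sigma>\<^sup>2 * xs k"
        "C (xs (k + 1)) (xs i) = \<sigma>0\<^sup>2 + \<sigma>\<^sup>2 * (xs k + d)"
        using x lt unfolding xk[symmetric] by (auto simp: C_def min_absorb1)
      then show ?thesis using d(1) by (simp add: d(2) field_simps)
    qed
    have "C x x = \<sigma>0\<^sup>2 + \<sigma>\<^sup>2 * (xs k + q)" "C (xs k) x = \<sigma>0\<^sup>2 + \<sigma>\<^sup>2 * xs k"
      "C (xs (k + 1)) x = \<sigma>0\<^sup>2 + \<sigma>\<^sup>2 * (xs k + q)"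
      using x lt unfolding xk(1)[symmetric] by (auto simp: C_def min_absorb1 min_absorb2)
    \<comment> \<open>The variance of a Brownian bridge over an interval of length \<open>d\<close>,
      at distances \<open>q\<close> and \<open>p\<close> from its ends.\<close>
    then have v: "\<sigma>\<^sup>2 * p * q / d = C x x - p / d * C (xs k) x - q / d * C (xs (k + 1)) x"
      using d(1) by (simp add: d(2) field_simps)
    have mean: "\<mu>0 + \<mu> * x = 0 + p / d * (\<mu>0 + \<mu> * xs k) + q / d * (\<mu>0 + \<mu> * xs (k + 1))"
      unfolding xk using d(1) by (simp add: d(2) field_simps)
    note K = key[OF kn mean interp v]
    show "AE \<omega> in M. real_cond_exp M D (f x) \<omega> =
           (xs (k + 1) - x) / (xs (k + 1) - xs k) * real_cond_exp M D (f (xs k)) \<omega>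
           + (x - xs k) / (xs (k + 1) - xs k) * real_cond_exp M D (f (xs (k + 1))) \<omega>"
      using K(1) by (simp add: p_def q_def d_def)
    have quad: "1 / d\<^sup>2 * ((vector [p, q] :: real ^ 2) \<bullet>
          (cond_cov_matrix M D (\<lambda>\<omega>. vector [f (xs k) \<omega>, f (xs (k + 1)) \<omega>] :: real ^ 2) \<omega> *v vector [p, q]))
        = (p / d)\<^sup>2 * cond_cov M D (f (xs k)) (f (xs k)) \<omega> + p / d * (q / d) * cond_cov M D (f (xs k)) (f (xs (k + 1))) \<omega>
        + q / d * (p / d) * cond_cov M D (f (xs (k + 1))) (f (xs k)) \<omega> + (q / d)\<^sup>2 * cond_cov M D (f (xs (k + 1))) (f (xs (k + 1))) \<omega>"
      for \<omega>
      using d(1)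
      by (simp add: inner_vec_def matrix_vector_mult_def sum_2 cond_cov_matrix_def power2_eq_square field_simps)
    show "AE \<omega> in M. cond_var M D (f x) \<omega> =
           1 / (xs (k + 1) - xs k)\<^sup>2 *
             ((vector [xs (k + 1) - x, x - xs k] :: real ^ 2) \<bullet>
              (cond_cov_matrix M D (\<lambda>\<omega>. vector [f (xs k) \<omega>, f (xs (k + 1)) \<omega>] :: real ^ 2) \<omega>
                 *v vector [xs (k + 1) - x, x - xs k]))
           + \<sigma>\<^sup>2 * (xs (k + 1) - x) * (x - xs k) / (xs (k + 1) - xs k)"
      using K(2) unfolding p_def[symmetric] q_def[symmetric] d_def[symmetric] quad .
  next
    assume x: "xs n \<le> x"
    have n: "n \<in> {1..n}" using assms(5) by simp
    \<comment> \<open>Weight 1 on the last point: the increment of \<open>f\<close> after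
      \<open>xs n\<close> is uncorrelated with all sampled values, and its drift becomes the
      intercept.\<close>
    have interp: "C x (xs i) = 1 * C (xs n) (xs i) + 0 * C (xs n) (xs i)" if "i \<in> {1..n}" for i
      using xs_mono[of i n] that x by (simp add: C_def min_absorb2)
    have v: "\<sigma>\<^sup>2 * (x - xs n) = C x x - 1 * C (xs n) x - 0 * C (xs n) x"
      using x by (simp add: C_def min_absorb1 algebra_simps)
    have mean: "\<mu>0 + \<mu> * x = \<mu> * (x - xs n) + 1 * (\<mu>0 + \<mu> * xs n) + 0 * (\<mu>0 + \<mu> * xs n)"
      by (simp add: algebra_simps)
    note K = key[OF n n mean interp v]
    show "AE \<omega> in M. real_cond_exp M D (f x) \<omega> = real_cond_exp M D (f (xs n)) \<omega> + \<mu> * (x - xs n)"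
      using K(1) by (simp add: algebra_simps)
    show "AE \<omega> in M. cond_var M D (f x) \<omega> = cond_var M D (f (xs n)) \<omega> + \<sigma>\<^sup>2 * (x - xs n)"
      using K(2) unfolding G.cond_var_eq_cond_cov[of "f (xs n)"] by simp
  qed
qed

end
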